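(* Let $M\subset\mathbb{P}^n$ be a quasiprojective variety that is the union of an increasing sequence of open subsets $M_j\subset\mathbb{P}^n$, each of which is biholomorphic to a domain $\Omega\subset\mathbb{C}^n$. If $\Omega$ is bounded and $\Omega/\operatorname{Aut}(\Omega)$ is compact, then $M$ cannot be hyperbolic. Further, if $\Omega=\mathbb{B}^n$ or $\Delta^n$, then the corank of $F_M$ is at least $2$.
   Context: $\mathbb{P}^n$ is the standard $n$-dimensional complex projective space; $\mathbb{B}^n$ and $\Delta^n$ are the unit ball and the unit polydisc in $\mathbb{C}^n$. $\operatorname{Aut}(\Omega)$ is the group of holomorphic automorphisms of $\Omega$ with the compact-open topology. Hyperbolic means Kobayashi hyperbolic. $F_M$ is the infinitesimal Kobayashi metric of $M$; its corank is the complex dimension of $\{v\in T_pM:F_M(p,v)=0\}$ (with $T_pM$ the holomorphic tangent space), which is independent of $p$ in this setting.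
   Formalization: The formal theorem takes n at least 1, and n at least 2 for the corank claim: for n = 1, M = C in P^1 is an increasing union of discs and F_M has corank 1; for n = 0, M is a point, which is hyperbolic. *)

theory Defs
  imports "HOL-Analysis.Analysis" "HOL-Combinatorics.Transposition"
begin

section \<open>Complex projective space\<close>

text \<open>
  With \<open>n = CARD('n)\<close>, the homogeneous coordinates on the \<open>n\<close>-dimensional projective space are
  indexed by \<open>'n option\<close>, which has \<open>n + 1\<close> elements.
\<close>

definition proj_rel :: "complex ^ 'n::finite option \<Rightarrow> complex ^ 'n option \<Rightarrow> bool" where
  "proj_rel z w \<longleftrightarrow> z \<noteq> 0 \<and> w \<noteq> 0 \<and> (\<exists>c. w = c *s z)"

lemma part_equivp_proj_rel: "part_equivp (proj_rel :: complex ^ 'n::finite option \<Rightarrow> _)"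
proof (rule part_equivpI)
  have "axis None 1 \<noteq> (0 :: complex ^ 'n option)"
    by (simp add: axis_eq_0_iff)
  then have "proj_rel (axis None 1 :: complex ^ 'n option) (axis None 1)"
    unfolding proj_rel_def by (metis vector_smult_lid)
  then show "\<exists>z :: complex ^ 'n option. proj_rel z z" by blast
  show "symp (proj_rel :: complex ^ 'n option \<Rightarrow> _)"
  proof (rule sympI)
    fix z w :: "complex ^ 'n option" assume zw: "proj_rel z w"
    then obtain c where c: "w = c *s z" and nz: "z \<noteq> 0" "w \<noteq> 0"
      unfolding proj_rel_def by blast
    have "c \<noteq> 0" using c nz by auto
    then have "z = inverse c *s w" using c by (simp add: vector_smult_assoc)
    then show "proj_rel w z" using nz unfolding proj_rel_def by blast
  qed
  show "transp (proj_rel :: complex ^ 'n option \<Rightarrow> _)"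
    unfolding transp_def proj_rel_def by (metis vector_smult_assoc)
qed

quotient_type 'n cproj = "complex ^ ('n::finite) option" / partial: proj_rel
  morphisms rep_cproj proj
  by (rule part_equivp_proj_rel)

instantiation cproj :: (finite) topological_space
begin

definition open_cproj :: "'a cproj set \<Rightarrow> bool" where
  "open_cproj U \<longleftrightarrow> open {z. z \<noteq> 0 \<and> proj z \<in> U}"

instance
proof
  have "{z :: complex ^ 'a option. z \<noteq> 0 \<and> proj z \<in> UNIV} = - {0}" by auto
  then show "open (UNIV :: 'a cproj set)" unfolding open_cproj_def by (simp add: open_Compl)
next
  fix S T :: "'a cproj set" assume "open S" "open T"
  then have "open ({z. z \<noteq> 0 \<and> proj z \<in> S} \<inter> {z. z \<noteq> 0 \<and> proj z \<in> T})"
    unfolding open_cproj_def by (rule open_Int)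
  also have "\<dots> = {z. z \<noteq> 0 \<and> proj z \<in> S \<inter> T}" by auto
  finally show "open (S \<inter> T)" unfolding open_cproj_def .
next
  fix K :: "'a cproj set set" assume "\<forall>S\<in>K. open S"
  then have "open (\<Union>S\<in>K. {z. z \<noteq> 0 \<and> proj z \<in> S})"
    unfolding open_cproj_def by (intro open_UN) auto
  also have "(\<Union>S\<in>K. {z. z \<noteq> 0 \<and> proj z \<in> S}) = {z. z \<noteq> 0 \<and> proj z \<in> \<Union>K}" by auto
  finally show "open (\<Union>K)" unfolding open_cproj_def .
qed

end

lemma proj_eq_iff:
  assumes "z \<noteq> 0" "w \<noteq> 0"
  shows "proj z = proj w \<longleftrightarrow> (\<exists>c. w = c *s z)"
proof -
  have refl: "proj_rel v v" if "v \<noteq> 0" for v :: "complex ^ 'a option"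
    using that unfolding proj_rel_def by (metis vector_smult_lid)
  have "proj_rel z w \<longleftrightarrow> proj z = proj w"
    using Quotient3_rel[OF Quotient3_cproj, of z w] refl[OF assms(1)] refl[OF assms(2)] by simp
  then show ?thesis using assms unfolding proj_rel_def by simp
qed

text \<open>
  The affine charts. The chart at \<open>i\<close> lives where the homogeneous coordinate \<open>i\<close> does not vanish.
  It consists of the quotients by that coordinate of the \<open>n\<close> others, and these are indexed by \<open>'n\<close>
  through the transposition of \<open>None\<close> and \<open>i\<close>.
\<close>

lift_definition chart_dom :: "'n::finite option \<Rightarrow> 'n cproj \<Rightarrow> bool" is "\<lambda>i z. z $ i \<noteq> 0"
  by (auto simp: proj_rel_def)

lift_definition chart :: "'n::finite option \<Rightarrow> 'n cproj \<Rightarrow> complex ^ 'n"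
  is "\<lambda>i z. \<chi> k. z $ Transposition.transpose None i (Some k) / z $ i"
proof -
  fix i :: "'n option" and z w :: "complex ^ 'n option"
  assume "proj_rel z w"
  then obtain c where c: "w = c *s z" and "w \<noteq> 0" unfolding proj_rel_def by blast
  then have "c \<noteq> 0" by auto
  then show "(\<chi> k. z $ Transposition.transpose None i (Some k) / z $ i)
      = (\<chi> k. w $ Transposition.transpose None i (Some k) / w $ i)"
    by (simp add: c vec_eq_iff)
qed

definition chart_inv :: "'n::finite option \<Rightarrow> complex ^ 'n \<Rightarrow> 'n cproj" where
  "chart_inv i x = proj (\<chi> j. case Transposition.transpose None i j of None \<Rightarrow> 1 | Some k \<Rightarrow> x $ k)"

lemma chart_dom_proj: "z \<noteq> 0 \<Longrightarrow> chart_dom i (proj z) \<longleftrightarrow> z $ i \<noteq> 0"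
  by (rule chart_dom.abs_eq) (metis proj_rel_def vector_smult_lid)

lemma chart_proj: "z \<noteq> 0 \<Longrightarrow> chart i (proj z) = (\<chi> k. z $ Transposition.transpose None i (Some k) / z $ i)"
  by (rule chart.abs_eq) (metis proj_rel_def vector_smult_lid)

lemma cproj_cases: obtains z where "z \<noteq> 0" "p = proj z"
proof
  have "proj_rel (rep_cproj p) (rep_cproj p)"
    using Quotient3_cproj by (rule Quotient3_rep_reflp)
  then show "rep_cproj p \<noteq> 0" by (simp add: proj_rel_def)
  show "p = proj (rep_cproj p)"
    by (rule Quotient3_abs_rep[OF Quotient3_cproj, symmetric])
qed

lemma chart_chart_inv: "chart_dom i (chart_inv i x)" "chart i (chart_inv i x) = x"
proof -
  define z :: "complex ^ 'a option"
    where "z = (\<chi> j. case Transposition.transpose None i j of None \<Rightarrow> 1 | Some k \<Rightarrow> x $ k)"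
  have zi: "z $ i = 1" by (simp add: z_def)
  then have "z \<noteq> 0" by auto
  moreover have "chart_inv i x = proj z" by (simp add: chart_inv_def z_def)
  ultimately show "chart_dom i (chart_inv i x)" "chart i (chart_inv i x) = x"
    by (simp_all add: chart_dom_proj chart_proj zi) (simp add: z_def vec_eq_iff)
qed

lemma chart_inv_chart: "chart_dom i p \<Longrightarrow> chart_inv i (chart i p) = p"
proof -
  assume p: "chart_dom i p"
  obtain z where z: "z \<noteq> 0" "p = proj z" by (rule cproj_cases)
  define w :: "complex ^ 'a option"
    where "w = (\<chi> j. case Transposition.transpose None i j of None \<Rightarrow> 1 | Some k \<Rightarrow> chart i p $ k)"
  have zi: "z $ i \<noteq> 0" using p z chart_dom_proj by blast
  have "z $ j = z $ i * w $ j" for j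
  proof (cases "Transposition.transpose None i j")
    case None
    then have "j = i"
      by (metis Transposition.transpose_apply_first Transposition.transpose_involutory)
    then show ?thesis by (simp add: w_def)
  next
    case (Some k)
    then have "Transposition.transpose None i (Some k) = j"
      by (metis Transposition.transpose_involutory)
    then show ?thesis using zi by (simp add: w_def Some z chart_proj[OF z(1)])
  qed
  then have eq: "z = (z $ i) *s w" unfolding vec_eq_iff vector_smult_component by blast
  have "w \<noteq> 0"
  proof
    assume "w = 0"
    with eq have "z = z $ i *s 0" by metis
    then show False using z(1) by (metis vector_smult_rzero)
  qed
  then have "proj w = proj z" using eq z(1) proj_eq_iff by blast
  then show ?thesis unfolding chart_inv_def w_def[symmetric] z(2)[symmetric] .
qed


section \<open>Quasiprojective varieties\<close>

definition homogeneous_form :: "nat \<Rightarrow> (complex ^ 'm::finite \<Rightarrow> complex) \<Rightarrow> bool" where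
  "homogeneous_form d P \<longleftrightarrow>
     (\<exists>c. P = (\<lambda>z. \<Sum>\<alpha>\<in>{\<alpha> :: 'm \<Rightarrow> nat. sum \<alpha> UNIV = d}. c \<alpha> * (\<Prod>i\<in>UNIV. z $ i ^ \<alpha> i)))"

lemma finite_exponents: "finite {\<alpha> :: 'm::finite \<Rightarrow> nat. sum \<alpha> UNIV = d}"
proof (rule finite_subset)
  show "{\<alpha> :: 'm \<Rightarrow> nat. sum \<alpha> UNIV = d} \<subseteq> PiE UNIV (\<lambda>_. {..d})"
  proof
    fix \<alpha> :: "'m \<Rightarrow> nat" assume "\<alpha> \<in> {\<alpha>. sum \<alpha> UNIV = d}"
    then have "\<alpha> i \<le> d" for i using member_le_sum[of i UNIV \<alpha>] by simp
    then show "\<alpha> \<in> PiE UNIV (\<lambda>_. {..d})" by (simp add: PiE_UNIV_domain)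
  qed
  show "finite (PiE (UNIV :: 'm set) (\<lambda>_. {..d}))" by (intro finite_PiE) auto
qed

definition zariski_closed :: "'n::finite cproj set \<Rightarrow> bool" where
  "zariski_closed Z \<longleftrightarrow>
     (\<exists>S. (\<forall>P\<in>S. \<exists>d. homogeneous_form d P) \<and> Z = {proj z | z. z \<noteq> 0 \<and> (\<forall>P\<in>S. P z = 0)})"

text \<open>
  Irreducibility is not part of the definition. It is automatic for a nonempty set that is also
  open in the Euclidean topology.
\<close>

definition quasiprojective :: "'n::finite cproj set \<Rightarrow> bool" where
  "quasiprojective M \<longleftrightarrow> (\<exists>Z W. zariski_closed Z \<and> zariski_closed W \<and> M = Z - W)"


section \<open>Holomorphic maps\<close>

text \<open>
  These notions are meant for an open set \<open>U\<close>. On such a set, complex differentiability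
  is real Frechet differentiability with a complex linear derivative.
\<close>

definition holo_on :: "(complex ^ 'm::finite \<Rightarrow> complex ^ 'n::finite) \<Rightarrow> (complex ^ 'm) set \<Rightarrow> bool" where
  "holo_on f U \<longleftrightarrow>
     (\<forall>x\<in>U. \<exists>D. (f has_derivative D) (at x) \<and> (\<forall>c v. D (c *s v) = c *s D v))"

definition holo_to_proj :: "(complex ^ 'm::finite \<Rightarrow> 'n::finite cproj) \<Rightarrow> (complex ^ 'm) set \<Rightarrow> bool" where
  "holo_to_proj f U \<longleftrightarrow>
     continuous_on U f \<and> (\<forall>i. holo_on (\<lambda>x. chart i (f x)) {x \<in> U. chart_dom i (f x)})"

definition holo_from_proj :: "('m::finite cproj \<Rightarrow> complex ^ 'n::finite) \<Rightarrow> 'm cproj set \<Rightarrow> bool" where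
  "holo_from_proj g V \<longleftrightarrow> (\<forall>i. holo_on (\<lambda>x. g (chart_inv i x)) {x. chart_inv i x \<in> V})"

definition biholomorphic_to_proj :: "(complex ^ 'n::finite) set \<Rightarrow> 'n cproj set \<Rightarrow> bool" where
  "biholomorphic_to_proj \<Omega> N \<longleftrightarrow>
     (\<exists>f. bij_betw f \<Omega> N \<and> holo_to_proj f \<Omega> \<and> holo_from_proj (inv_into \<Omega> f) N)"


section \<open>Domains and their automorphism groups\<close>

definition complex_domain :: "(complex ^ 'n::finite) set \<Rightarrow> bool" where
  "complex_domain \<Omega> \<longleftrightarrow> open \<Omega> \<and> connected \<Omega> \<and> \<Omega> \<noteq> {}"

definition unit_polydisc :: "(complex ^ 'n::finite) set" where
  "unit_polydisc = {z. \<forall>i. cmod (z $ i) < 1}"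

definition Aut :: "(complex ^ 'n::finite) set \<Rightarrow> (complex ^ 'n \<Rightarrow> complex ^ 'n) set" where
  "Aut \<Omega> = {f. bij_betw f \<Omega> \<Omega> \<and> holo_on f \<Omega> \<and> holo_on (inv_into \<Omega> f) \<Omega>}"

definition Aut_orbit :: "(complex ^ 'n::finite) set \<Rightarrow> complex ^ 'n \<Rightarrow> (complex ^ 'n) set" where
  "Aut_orbit \<Omega> x = (\<lambda>f. f x) ` Aut \<Omega>"

text \<open>The orbit space \<open>\<Omega>/Aut(\<Omega>)\<close>, with the quotient topology.\<close>

definition Aut_quotient :: "(complex ^ 'n::finite) set \<Rightarrow> (complex ^ 'n) set topology" where
  "Aut_quotient \<Omega> = topology (\<lambda>U. U \<subseteq> Aut_orbit \<Omega> ` \<Omega> \<and>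
     openin (top_of_set \<Omega>) {x \<in> \<Omega>. Aut_orbit \<Omega> x \<in> U})"

lemma openin_Aut_quotient:
  "openin (Aut_quotient \<Omega>) U \<longleftrightarrow>
     U \<subseteq> Aut_orbit \<Omega> ` \<Omega> \<and> openin (top_of_set \<Omega>) {x \<in> \<Omega>. Aut_orbit \<Omega> x \<in> U}"
proof -
  let ?T = "\<lambda>U. U \<subseteq> Aut_orbit \<Omega> ` \<Omega> \<and> openin (top_of_set \<Omega>) {x \<in> \<Omega>. Aut_orbit \<Omega> x \<in> U}"
  have "istopology ?T"
    unfolding istopology_def
  proof (intro conjI allI impI)
    fix S T assume "?T S" "?T T"
    moreover have "{x \<in> \<Omega>. Aut_orbit \<Omega> x \<in> S \<inter> T}
        = {x \<in> \<Omega>. Aut_orbit \<Omega> x \<in> S} \<inter> {x \<in> \<Omega>. Aut_orbit \<Omega> x \<in> T}" by auto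
    ultimately show "S \<inter> T \<subseteq> Aut_orbit \<Omega> ` \<Omega>"
      "openin (top_of_set \<Omega>) {x \<in> \<Omega>. Aut_orbit \<Omega> x \<in> S \<inter> T}" by auto
  next
    fix K assume K: "\<forall>S\<in>K. ?T S"
    then show "\<Union>K \<subseteq> Aut_orbit \<Omega> ` \<Omega>" by auto
    have "{x \<in> \<Omega>. Aut_orbit \<Omega> x \<in> \<Union>K} = (\<Union>S\<in>K. {x \<in> \<Omega>. Aut_orbit \<Omega> x \<in> S})" by auto
    then show "openin (top_of_set \<Omega>) {x \<in> \<Omega>. Aut_orbit \<Omega> x \<in> \<Union>K}"
      using K by (auto intro: openin_Union)
  qed
  then show ?thesis unfolding Aut_quotient_def by (simp add: topology_inverse')
qed

lemma quotient_map_Aut_orbit: "quotient_map (top_of_set \<Omega>) (Aut_quotient \<Omega>) (Aut_orbit \<Omega>)"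
proof -
  have "{x \<in> \<Omega>. Aut_orbit \<Omega> x \<in> Aut_orbit \<Omega> ` \<Omega>} = \<Omega>" by auto
  then have "openin (Aut_quotient \<Omega>) (Aut_orbit \<Omega> ` \<Omega>)"
    by (simp add: openin_Aut_quotient)
  then have "topspace (Aut_quotient \<Omega>) = Aut_orbit \<Omega> ` \<Omega>"
    by (intro subset_antisym openin_subset) (use openin_Aut_quotient openin_topspace in blast)+
  then show ?thesis unfolding quotient_map_def by (simp add: openin_Aut_quotient)
qed


section \<open>The Kobayashi pseudodistance and the infinitesimal Kobayashi metric\<close>

definition holo_disc :: "'n::finite cproj set \<Rightarrow> (complex \<Rightarrow> 'n cproj) \<Rightarrow> bool" where
  "holo_disc M f \<longleftrightarrow> f ` ball 0 1 \<subseteq> M \<and> continuous_on (ball 0 1) f \<and>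
     (\<forall>i k. (\<lambda>z. chart i (f z) $ k) holomorphic_on {z \<in> ball 0 1. chart_dom i (f z)})"

definition poincare_dist :: "complex \<Rightarrow> complex \<Rightarrow> real" where
  "poincare_dist a b = artanh (cmod ((a - b) / (1 - cnj a * b)))"

text \<open>
  A chain of discs from \<open>p\<close> to \<open>q\<close> is a nonempty list of triples \<open>(f, a, b)\<close>, where \<open>f\<close> is a
  holomorphic disc in \<open>M\<close> that joins \<open>f a\<close> to \<open>f b\<close>.
\<close>

definition disc_chains ::
  "'n::finite cproj set \<Rightarrow> 'n cproj \<Rightarrow> 'n cproj \<Rightarrow> ((complex \<Rightarrow> 'n cproj) \<times> complex \<times> complex) list set" where
  "disc_chains M p q = {cs. cs \<noteq> [] \<and>
     (\<forall>(f, a, b)\<in>set cs. holo_disc M f \<and> a \<in> ball 0 1 \<and> b \<in> ball 0 1) \<and>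
     (case hd cs of (f, a, b) \<Rightarrow> f a = p) \<and>
     (case last cs of (f, a, b) \<Rightarrow> f b = q) \<and>
     successively (\<lambda>(f, a, b) (g, c, d). f b = g c) cs}"

definition kobayashi_dist :: "'n::finite cproj set \<Rightarrow> 'n cproj \<Rightarrow> 'n cproj \<Rightarrow> ereal" where
  "kobayashi_dist M p q =
     (INF cs\<in>disc_chains M p q. ereal (\<Sum>(f, a, b)\<leftarrow>cs. poincare_dist a b))"

definition kobayashi_hyperbolic :: "'n::finite cproj set \<Rightarrow> bool" where
  "kobayashi_hyperbolic M \<longleftrightarrow> (\<forall>p\<in>M. \<forall>q\<in>M. p \<noteq> q \<longrightarrow> kobayashi_dist M p q > 0)"

text \<open>
  A holomorphic tangent vector at \<open>p\<close> is given by its components \<open>v\<close> in the chart at \<open>i\<close>,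
  where \<open>p\<close> lies in the domain of that chart.
\<close>

definition kobayashi_metric ::
  "'n::finite cproj set \<Rightarrow> 'n option \<Rightarrow> 'n cproj \<Rightarrow> complex ^ 'n \<Rightarrow> real" where
  "kobayashi_metric M i p v = Inf {\<alpha>. 0 < \<alpha> \<and>
     (\<exists>f. holo_disc M f \<and> f 0 = p \<and>
        (\<forall>k. complex_of_real \<alpha> * deriv (\<lambda>z. chart i (f z) $ k) 0 = v $ k))}"

text \<open>
  The corank as a relation: at every point and in every chart, the null set of the metric is
  a complex linear subspace of dimension \<open>r\<close>.
\<close>

definition has_kobayashi_corank :: "'n::finite cproj set \<Rightarrow> nat \<Rightarrow> bool" where
  "has_kobayashi_corank M r \<longleftrightarrow>
     (\<forall>p\<in>M. \<forall>i. chart_dom i p \<longrightarrow>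
        vec.subspace {v. kobayashi_metric M i p v = 0} \<and>
        vec.dim {v. kobayashi_metric M i p v = 0} = r)"

end

theory Submission
  imports Defs "HOL-Complex_Analysis.Riemann_Mapping"
begin

text \<open>
  Both the Kobayashi pseudodistance (between suitable points) and the infinitesimal metric of \<open>M\<close>
  vanish, so the corank is \<open>n\<close>. Compactness of the quotient (or homogeneity of the ball and the
  polydisc) gives \<open>r > 0\<close> such that, for \<open>p\<close> in the \<open>j\<close>-th set of the exhaustion, there is a biholomorphic map \<open>g\<close> of
  this set onto \<open>\<Omega>\<close> for which \<open>\<Omega>\<close> contains the ball of radius \<open>r\<close> about \<open>g p\<close>. A complex line through \<open>p\<close>
  meets the complement of \<open>M\<close> in a finite set, and \<open>g\<close> is bounded independently of \<open>j\<close>, so a quantitative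
  form of Liouville's theorem on the punctured line shows that \<open>g\<close> is nearly constant on the line near \<open>p\<close>
  for large \<open>j\<close>. Small affine displacements in the ball of radius \<open>r\<close> are joined by discs of small
  Kobayashi length, and these are carried back to \<open>M\<close> by the inverse of \<open>g\<close>.
\<close>

section \<open>Complex linear derivatives\<close>

lemma norm_vector_smult: "norm (c *s (v :: complex ^ 'n::finite)) = cmod c * norm v"
  by (simp add: norm_vec_def norm_mult L2_set_right_distrib)

lemma norm_le_sum_components: "norm (v :: complex ^ 'n::finite) \<le> (\<Sum>k\<in>UNIV. cmod (v $ k))"
  unfolding norm_vec_def by (rule L2_set_le_sum) simp

lemma bounded_linear_smult_left: "bounded_linear (\<lambda>t. t *s (v :: complex ^ 'n::finite))"
  by (rule bounded_linear_intro[where K = "norm v"])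
     (simp_all add: vec_eq_iff algebra_simps norm_vector_smult)

lemma bounded_linear_axis: "bounded_linear (axis k :: complex \<Rightarrow> complex ^ 'n::finite)"
proof (rule bounded_linear_intro[where K = 1])
  fix x :: complex
  show "norm (axis k x :: complex ^ 'n) \<le> norm x * 1"
    using norm_le_sum_components[of "axis k x :: complex ^ 'n"]
    by (simp add: axis_def if_distrib[of cmod] cong: if_cong)
qed (auto simp: vec_eq_iff axis_def)

lemma has_derivative_componentwise_vec:
  fixes f :: "'a::real_normed_vector \<Rightarrow> complex ^ 'n::finite"
  assumes "\<And>k. ((\<lambda>x. f x $ k) has_derivative D k) (at x)"
  shows "(f has_derivative (\<lambda>v. \<chi> k. D k v)) (at x)"
proof -
  have sum_axis: "(\<chi> k. g k) = (\<Sum>k\<in>UNIV. axis k (g k))" for g :: "'n \<Rightarrow> complex"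
    by (simp add: vec_eq_iff axis_def if_distrib cong: if_cong)
  have "((\<lambda>x. \<Sum>k\<in>UNIV. axis k (f x $ k)) has_derivative (\<lambda>v. \<Sum>k\<in>UNIV. axis k (D k v))) (at x)"
    by (intro has_derivative_sum bounded_linear.has_derivative[OF bounded_linear_axis] assms)
  then show ?thesis by (simp flip: sum_axis)
qed

section \<open>Complex differentiability of scalar functions of several variables\<close>

text \<open>The scalar counterpart of the pointwise condition in \<open>holo_on\<close>. It lets
  maps given by rational formulas be treated one component at a time.\<close>

definition cdiff_at :: "(complex ^ 'm::finite \<Rightarrow> complex) \<Rightarrow> complex ^ 'm \<Rightarrow> bool" where
  "cdiff_at h x \<longleftrightarrow> (\<exists>D. (h has_derivative D) (at x) \<and> (\<forall>c v. D (c *s v) = c * D v))"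

lemma cdiff_at_const: "cdiff_at (\<lambda>_. c) x"
  unfolding cdiff_at_def by (rule exI[of _ "\<lambda>_. 0"]) simp

lemma cdiff_at_component: "cdiff_at (\<lambda>z. z $ k) x"
  unfolding cdiff_at_def by (rule exI[of _ "\<lambda>v. v $ k"])
    (simp add: bounded_linear.has_derivative[OF bounded_linear_vec_nth])

lemma cdiff_at_diff:
  assumes "cdiff_at f x" "cdiff_at g x"
  shows "cdiff_at (\<lambda>z. f z - g z) x"
proof -
  obtain D E where "(f has_derivative D) (at x)" "\<forall>c v. D (c *s v) = c * D v"
    "(g has_derivative E) (at x)" "\<forall>c v. E (c *s v) = c * E v"
    using assms unfolding cdiff_at_def by blast
  then show ?thesis unfolding cdiff_at_def
    by (intro exI[of _ "\<lambda>v. D v - E v"] conjI has_derivative_diff) (auto simp: algebra_simps)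
qed

lemma cdiff_at_mult:
  assumes "cdiff_at f x" "cdiff_at g x"
  shows "cdiff_at (\<lambda>z. f z * g z) x"
proof -
  obtain D E where "(f has_derivative D) (at x)" "\<forall>c v. D (c *s v) = c * D v"
    "(g has_derivative E) (at x)" "\<forall>c v. E (c *s v) = c * E v"
    using assms unfolding cdiff_at_def by blast
  then show ?thesis unfolding cdiff_at_def
    by (intro exI[of _ "\<lambda>v. f x * E v + D v * g x"] conjI has_derivative_mult)
       (auto simp: algebra_simps)
qed

lemma cdiff_at_sum:
  assumes "\<And>k. cdiff_at (f k) x"
  shows "cdiff_at (\<lambda>z. \<Sum>k\<in>(A :: 'k set). f k z) x"
proof -
  have "\<exists>D. \<forall>k. (f k has_derivative D k) (at x) \<and> (\<forall>c v. D k (c *s v) = c * D k v)"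
    using assms unfolding cdiff_at_def by (intro choice) blast
  then obtain D where "\<And>k. (f k has_derivative D k) (at x)" "\<And>k c v. D k (c *s v) = c * D k v"
    by blast
  then show ?thesis unfolding cdiff_at_def
    by (intro exI[of _ "\<lambda>v. \<Sum>k\<in>A. D k v"] conjI has_derivative_sum) (auto simp: sum_distrib_left)
qed

lemma cdiff_at_compose:
  assumes "cdiff_at f x" "\<phi> field_differentiable at (f x)"
  shows "cdiff_at (\<lambda>z. \<phi> (f z)) x"
proof -
  obtain D d where D: "(f has_derivative D) (at x)" "\<forall>c v. D (c *s v) = c * D v"
    and "(\<phi> has_field_derivative d) (at (f x))"
    using assms unfolding cdiff_at_def field_differentiable_def by blast
  then have "((\<lambda>z. \<phi> (f z)) has_derivative (\<lambda>v. d * D v)) (at x)"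
    using has_derivative_compose[OF D(1)] unfolding has_field_derivative_def by blast
  with D(2) show ?thesis unfolding cdiff_at_def
    by (intro exI[of _ "\<lambda>v. d * D v"]) simp
qed

lemma cdiff_at_divide:
  assumes "cdiff_at f x" "cdiff_at g x" "g x \<noteq> 0"
  shows "cdiff_at (\<lambda>z. f z / g z) x"
proof -
  have "cdiff_at (\<lambda>z. inverse (g z)) x"
    using assms(2,3) by (rule cdiff_at_compose[OF _ field_differentiable_inverse[OF field_differentiable_ident]])
  from cdiff_at_mult[OF assms(1) this] show ?thesis by (simp add: divide_inverse)
qed

lemma holo_onI_components:
  assumes "\<And>x k. x \<in> U \<Longrightarrow> cdiff_at (\<lambda>z. f z $ k) x"
  shows "holo_on f U"
  unfolding holo_on_def
proof
  fix x assume "x \<in> U"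
  then have "\<exists>D. \<forall>k. ((\<lambda>z. f z $ k) has_derivative D k) (at x) \<and> (\<forall>c v. D k (c *s v) = c * D k v)"
    using assms unfolding cdiff_at_def by (intro choice) blast
  then obtain D where "\<And>k. ((\<lambda>z. f z $ k) has_derivative D k) (at x)"
    and "\<And>k c v. D k (c *s v) = c * D k v" by blast
  then show "\<exists>D. (f has_derivative D) (at x) \<and> (\<forall>c v. D (c *s v) = c *s D v)"
    by (intro exI[of _ "\<lambda>v. \<chi> k. D k v"] conjI has_derivative_componentwise_vec)
       (auto simp: vec_eq_iff)
qed

section \<open>Holomorphic maps: composition and restriction to complex lines\<close>

lemma holo_onE:
  assumes "holo_on f U" "x \<in> U"
  obtains D where "(f has_derivative D) (at x)" "\<And>c v. D (c *s v) = c *s D v"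
  using assms unfolding holo_on_def by blast

lemma holo_on_subset: "holo_on f U \<Longrightarrow> V \<subseteq> U \<Longrightarrow> holo_on f V"
  unfolding holo_on_def by blast

lemma holo_on_imp_continuous_on: "holo_on f U \<Longrightarrow> continuous_on U f"
  unfolding holo_on_def
  by (meson continuous_at_imp_continuous_on has_derivative_continuous)

lemma holo_on_cong:
  assumes "holo_on f U" "open U" "\<And>x. x \<in> U \<Longrightarrow> g x = f x"
  shows "holo_on g U"
  unfolding holo_on_def
proof
  fix x assume "x \<in> U"
  with assms(1) obtain D where D: "(f has_derivative D) (at x)" "\<And>c v. D (c *s v) = c *s D v"
    by (rule holo_onE) blast
  have "(g has_derivative D) (at x)"
    using D(1) assms(2) \<open>x \<in> U\<close> by (rule has_derivative_transform_within_open) (simp add: assms(3))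
  with D(2) show "\<exists>D. (g has_derivative D) (at x) \<and> (\<forall>c v. D (c *s v) = c *s D v)" by blast
qed

lemma holo_on_compose:
  assumes "holo_on f U" "holo_on g V" "f ` U \<subseteq> V"
  shows "holo_on (\<lambda>x. g (f x)) U"
  unfolding holo_on_def
proof
  fix x assume "x \<in> U"
  with assms(1) obtain D where D: "(f has_derivative D) (at x)" "\<And>c v. D (c *s v) = c *s D v"
    by (rule holo_onE) blast
  have "f x \<in> V" using assms(3) \<open>x \<in> U\<close> by blast
  with assms(2) obtain E where E: "(g has_derivative E) (at (f x))" "\<And>c v. E (c *s v) = c *s E v"
    by (rule holo_onE) blast
  show "\<exists>D. ((\<lambda>x. g (f x)) has_derivative D) (at x) \<and> (\<forall>c v. D (c *s v) = c *s D v)"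
    by (intro exI[of _ "\<lambda>v. E (D v)"] conjI has_derivative_compose[OF D(1) E(1)])
       (simp add: D(2) E(2))
qed

text \<open>By complex linearity of \<open>D\<close>, the restriction to a complex line has the
  derivative \<open>c \<mapsto> c *s D v\<close>, so its components are holomorphic in one variable.
  This is the passage from several variables to discs and lines.\<close>

lemma has_derivative_along_line:
  fixes x :: "complex ^ 'm::finite" and f :: "complex ^ 'm \<Rightarrow> complex ^ 'n::finite"
  assumes "(f has_derivative D) (at (x + t *s v))" "\<And>c u. D (c *s u) = c *s D u"
  shows "((\<lambda>s. f (x + s *s v)) has_derivative (\<lambda>c. c *s D v)) (at t)"
proof -
  have "((\<lambda>s. x + s *s v) has_derivative (\<lambda>c. c *s v)) (at t)"
    by (auto intro!: derivative_eq_intros bounded_linear.has_derivative[OF bounded_linear_smult_left])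
  from has_derivative_compose[OF this assms(1)] show ?thesis by (simp add: assms(2))
qed

lemma has_field_derivative_component:
  assumes "(f has_derivative (\<lambda>c. c *s w)) (at (t :: complex))"
  shows "((\<lambda>s. f s $ k) has_field_derivative w $ k) (at t)"
  using bounded_linear.has_derivative[OF bounded_linear_vec_nth assms, of k]
  by (simp add: has_field_derivative_def mult.commute[of _ "w $ k"])

section \<open>Automorphisms\<close>

text \<open>Since \<open>\<Omega>\<close> is open, the explicit inverse \<open>g\<close> can replace
  \<open>inv_into \<Omega> f\<close>, with which it agrees only on \<open>\<Omega>\<close>.\<close>

lemma AutI:
  assumes "open \<Omega>" "holo_on f \<Omega>" "holo_on g \<Omega>" "f ` \<Omega> \<subseteq> \<Omega>" "g ` \<Omega> \<subseteq> \<Omega>"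
    and "\<And>x. x \<in> \<Omega> \<Longrightarrow> g (f x) = x" "\<And>x. x \<in> \<Omega> \<Longrightarrow> f (g x) = x"
  shows "f \<in> Aut \<Omega>"
proof -
  have bij: "bij_betw f \<Omega> \<Omega>"
  proof (rule bij_betwI)
    show "f \<in> \<Omega> \<rightarrow> \<Omega>" "g \<in> \<Omega> \<rightarrow> \<Omega>" using assms(4,5) by blast+
  qed (fact assms(6,7))+
  have "inv_into \<Omega> f x = g x" if "x \<in> \<Omega>" for x
  proof (rule inv_into_f_eq)
    show "inj_on f \<Omega>" using bij by (rule bij_betw_imp_inj_on)
    show "g x \<in> \<Omega>" using assms(5) that by blast
    show "f (g x) = x" using that by (rule assms(7))
  qed
  then have "holo_on (inv_into \<Omega> f) \<Omega>"
    by (rule holo_on_cong[OF assms(3,1)])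
  with bij assms(2) show ?thesis by (simp add: Aut_def)
qed

section \<open>Homogeneity of the polydisc and the ball\<close>

text \<open>A disc automorphism is applied in each coordinate. The parameter \<open>-a\<close> gives
  the inverse of the map with parameter \<open>a\<close>.\<close>

lemma polydisc_homogeneous:
  assumes "a \<in> (unit_polydisc :: (complex ^ 'n::finite) set)"
  shows "\<exists>\<phi>\<in>Aut unit_polydisc. \<phi> a = 0"
proof -
  define \<phi> where "\<phi> a z = (\<chi> k. Moebius_function 0 (a $ k) (z $ k))" for a z :: "complex ^ 'n"
  have holo: "holo_on (\<phi> a) unit_polydisc" and maps: "\<phi> a ` unit_polydisc \<subseteq> unit_polydisc"
    if "a \<in> unit_polydisc" for a
  proof (rule holo_onI_components)
    fix z :: "complex ^ 'n" and k assume "z \<in> unit_polydisc"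
    then have "Moebius_function 0 (a $ k) field_differentiable at (z $ k)"
      using Moebius_function_holomorphic[of "a $ k" 0] that
      by (intro holomorphic_on_imp_differentiable_at) (auto simp: unit_polydisc_def)
    then show "cdiff_at (\<lambda>z. \<phi> a z $ k) z"
      using cdiff_at_compose[OF cdiff_at_component] by (simp add: \<phi>_def)
  next
    show "\<phi> a ` unit_polydisc \<subseteq> unit_polydisc"
      using that by (auto simp: \<phi>_def unit_polydisc_def Moebius_function_norm_lt_1)
  qed
  have inv: "\<phi> (-a) (\<phi> a z) = z" if "a \<in> unit_polydisc" "z \<in> unit_polydisc" for a z
    using that by (simp add: \<phi>_def vec_eq_iff unit_polydisc_def Moebius_function_compose)
  have minus: "-a \<in> unit_polydisc" using assms by (simp add: unit_polydisc_def)
  have eq: "unit_polydisc = (\<Inter>k. (\<lambda>z :: complex ^ 'n. z $ k) -` ball 0 1)"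
    by (auto simp: unit_polydisc_def)
  have "open (unit_polydisc :: (complex ^ 'n) set)"
    unfolding eq by (intro open_INT finite ballI open_vimage open_ball continuous_on_component continuous_on_id)
  then have "\<phi> a \<in> Aut unit_polydisc"
    by (rule AutI[OF _ holo[OF assms] holo[OF minus] maps[OF assms] maps[OF minus]])
       (use inv[OF assms] inv[OF minus] in simp_all)
  moreover have "\<phi> a a = 0" by (simp add: \<phi>_def vec_eq_iff Moebius_function_eq_zero)
  ultimately show ?thesis by blast
qed

lemma complex_norm_square_vec:
  "complex_of_real ((norm (v :: complex ^ 'n::finite))\<^sup>2) = (\<Sum>k\<in>UNIV. v $ k * cnj (v $ k))"
  by (simp add: norm_vec_def L2_set_def sum_nonneg flip: complex_norm_square)

lemma ball_homogeneous:
  assumes "a \<in> ball (0 :: complex ^ 'n::finite) 1"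
  shows "\<exists>\<phi>\<in>Aut (ball 0 1). \<phi> a = 0"
proof -
  \<comment> \<open>This is the involution \<open>z \<mapsto> (a - P z - s Q z) / (1 - \<langle>z, a\<rangle>)\<close> with \<open>P\<close> the orthogonal projection
    onto the line through \<open>a\<close> and \<open>Q = 1 - P\<close>. Since \<open>(1 - s) / |a|\<^sup>2 = 1 / (1 + s)\<close>, the vector
    \<open>P z + s Q z\<close> equals \<open>s z + \<langle>z, a\<rangle> / (1 + s) a\<close>, which also makes sense for \<open>a = 0\<close>.\<close>
  define s where "s = sqrt (1 - (norm a)\<^sup>2)"
  define S where "S = complex_of_real s"
  have "(norm a)\<^sup>2 < 1" using assms by (simp add: power_less_one_iff)
  then have s: "s > 0" and s2: "s\<^sup>2 = 1 - (norm a)\<^sup>2" by (simp_all add: s_def)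
  have S: "S \<noteq> 0" "1 + S \<noteq> 0" "cnj S = S"
    using s by (auto simp: S_def complex_eq_iff)
  have aa: "(\<Sum>k\<in>UNIV. a $ k * cnj (a $ k)) = 1 - S\<^sup>2"
    by (simp add: S_def s2 flip: complex_norm_square_vec of_real_power)
  define ip where "ip z = (\<Sum>k\<in>UNIV. z $ k * cnj (a $ k))" for z :: "complex ^ 'n"
  define num where "num z = (\<chi> k. (1 - ip z / (1 + S)) * a $ k - S * z $ k)" for z :: "complex ^ 'n"
  define \<phi> where "\<phi> z = inverse (1 - ip z) *s num z" for z

  \<comment> \<open>This identity yields both that \<open>1 - ip z\<close> does not vanish on the
    ball and that \<phi> maps the ball to itself.\<close>
  have num_norm: "(norm (num z))\<^sup>2 = (cmod (1 - ip z))\<^sup>2 - s\<^sup>2 * (1 - (norm z)\<^sup>2)" for z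
  proof -
    define \<alpha> where "\<alpha> = 1 - ip z / (1 + S)"
    have cnj_ip: "cnj (ip z) = (\<Sum>k\<in>UNIV. a $ k * cnj (z $ k))"
      by (simp add: ip_def mult.commute)
    have cnj_\<alpha>: "cnj \<alpha> = 1 - cnj (ip z) / (1 + S)" by (simp add: \<alpha>_def S(3))
    have "complex_of_real ((norm (num z))\<^sup>2) =
        (\<Sum>k\<in>UNIV. \<alpha> * cnj \<alpha> * (a $ k * cnj (a $ k)) - S * \<alpha> * (a $ k * cnj (z $ k))
          - S * cnj \<alpha> * (z $ k * cnj (a $ k)) + S\<^sup>2 * (z $ k * cnj (z $ k)))"
      unfolding complex_norm_square_vec num_def \<alpha>_def[symmetric]
      by (intro sum.cong) (simp_all add: S(3) algebra_simps power2_eq_square)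
    also have "\<dots> = \<alpha> * cnj \<alpha> * (1 - S\<^sup>2) - S * \<alpha> * cnj (ip z) - S * cnj \<alpha> * ip z
        + S\<^sup>2 * complex_of_real ((norm z)\<^sup>2)"
      unfolding complex_norm_square_vec cnj_ip
      by (simp add: sum.distrib sum_subtractf aa ip_def flip: sum_distrib_left)
    also have "\<dots> = (1 - ip z) * (1 - cnj (ip z)) - S\<^sup>2 * (1 - complex_of_real ((norm z)\<^sup>2))"
    proof -
      \<comment> \<open>Expressing \<open>ip z\<close> through \<alpha> removes the division by
        \<open>1 + S\<close>, so that a polynomial identity remains.\<close>
      have "ip z = (1 - \<alpha>) * (1 + S)" "cnj (ip z) = (1 - cnj \<alpha>) * (1 + S)"
        using S(2) by (simp_all add: cnj_\<alpha>) (simp_all add: \<alpha>_def)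
      then show ?thesis by algebra
    qed
    also have "\<dots> = complex_of_real ((cmod (1 - ip z))\<^sup>2 - s\<^sup>2 * (1 - (norm z)\<^sup>2))"
      unfolding of_real_diff of_real_mult complex_norm_square[of "1 - ip z"] by (simp add: S_def)
    finally show ?thesis unfolding of_real_eq_iff .
  qed
  have lt: "norm (num z) < cmod (1 - ip z)" if "z \<in> ball 0 1" for z
  proof -
    have "(norm z)\<^sup>2 < 1" using that by (simp add: power_less_one_iff)
    then have "0 < s\<^sup>2 * (1 - (norm z)\<^sup>2)" using s by simp
    with num_norm[of z] have "(norm (num z))\<^sup>2 < (cmod (1 - ip z))\<^sup>2" by linarith
    then show ?thesis by (rule power2_less_imp_less) simp
  qed
  have nz: "1 - ip z \<noteq> 0" if "z \<in> ball 0 1" for z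
    using lt[OF that] by auto
  have maps: "\<phi> ` ball 0 1 \<subseteq> ball 0 1"
  proof clarify
    fix z :: "complex ^ 'n" assume "z \<in> ball 0 1"
    then show "\<phi> z \<in> ball 0 1"
      using lt[of z] nz[of z]
      by (simp add: \<phi>_def norm_vector_smult norm_inverse inverse_eq_divide[of "cmod _"])
  qed
  have involutive: "\<phi> (\<phi> z) = z" if "z \<in> ball 0 1" for z
  proof -
    define c where "c = ip z"
    have c: "1 - c \<noteq> 0" using nz[OF that] by (simp add: c_def)
    \<comment> \<open>With \<beta> left free, \<open>num z\<close> is the instance whose \<beta> is
      \<open>1 - ip z / (1 + S)\<close>.\<close>
    have "ip (\<chi> k. \<beta> * a $ k - S * z $ k) = \<beta> * (1 - S\<^sup>2) - S * ip z" for \<beta>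
      unfolding ip_def aa[symmetric] sum_distrib_left sum_subtractf[symmetric]
      by (intro sum.cong) (simp_all add: left_diff_distrib mult.assoc)
    then have "ip (num z) = (1 - c / (1 + S)) * (1 - S\<^sup>2) - S * c"
      by (simp add: num_def c_def)
    also have "\<dots> = 1 - S\<^sup>2 - c"
    proof -
      have "c = (c / (1 + S)) * (1 + S)" using S(2) by simp
      then show ?thesis by algebra
    qed
    finally have ip_num: "ip (num z) = 1 - S\<^sup>2 - c" .
    have "ip (\<phi> z) = inverse (1 - c) * ip (num z)"
      unfolding \<phi>_def c_def by (simp add: ip_def sum_distrib_left mult.assoc)
    then have ip_\<phi>: "(1 - c) * ip (\<phi> z) = 1 - S\<^sup>2 - c" using c ip_num by simp
    \<comment> \<open>The two denominators met in applying \<phi> twice multiply to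
      \<open>S\<^sup>2\<close>. The numerators below produce the same factor, which then
      cancels.\<close>
    then have den: "(1 - c) * (1 - ip (\<phi> z)) = S\<^sup>2" by (simp add: algebra_simps)
    have "\<phi> (\<phi> z) $ k = z $ k" for k
    proof -
      define n where "n = num z $ k"
      define u where "u = ip (\<phi> z) / (1 + S)"
      have u: "ip (\<phi> z) = u * (1 + S)" using S(2) by (simp add: u_def)
      define w where "w = c / (1 + S)"
      have w: "c = w * (1 + S)" using S(2) by (simp add: w_def)
      have n: "n = (1 - w) * a $ k - S * z $ k" by (simp add: n_def num_def w_def c_def)
      have "(1 + S) * ((1 - c) * (1 - u)) = (1 + S) * (S * (1 - w))"
        using ip_\<phi> u w by algebra
      then have uw: "(1 - c) * (1 - u) = S * (1 - w)" using S(2) by simp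
      have \<phi>k: "(1 - c) * \<phi> z $ k = n" using c by (simp add: \<phi>_def c_def n_def)
      have "(1 - c) * num (\<phi> z) $ k = (1 - c) * (1 - u) * a $ k - S * ((1 - c) * \<phi> z $ k)"
        by (simp add: num_def u_def algebra_simps)
      also have "\<dots> = S\<^sup>2 * z $ k"
        unfolding uw \<phi>k n by (simp add: algebra_simps power2_eq_square)
      also have "\<dots> = (1 - c) * ((1 - ip (\<phi> z)) * z $ k)" using den by (simp add: mult.assoc)
      finally have "num (\<phi> z) $ k = (1 - ip (\<phi> z)) * z $ k" using c by simp
      moreover have "1 - ip (\<phi> z) \<noteq> 0" using den S(1) by auto
      ultimately show ?thesis by (simp add: \<phi>_def[of "\<phi> z"])
    qed
    then show ?thesis by (simp add: vec_eq_iff)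
  qed
  have holo: "holo_on \<phi> (ball 0 1)"
  proof (rule holo_onI_components)
    fix z :: "complex ^ 'n" and k assume z: "z \<in> ball 0 1"
    have ip: "cdiff_at ip z" unfolding ip_def
      by (intro cdiff_at_sum cdiff_at_mult cdiff_at_component cdiff_at_const)
    have "cdiff_at (\<lambda>z. ((1 - ip z / (1 + S)) * a $ k - S * z $ k) / (1 - ip z)) z"
      using nz[OF z] S(2)
      by (intro cdiff_at_divide cdiff_at_diff cdiff_at_mult cdiff_at_component cdiff_at_const ip)
    then show "cdiff_at (\<lambda>z. \<phi> z $ k) z"
      by (simp add: \<phi>_def num_def divide_inverse mult.commute)
  qed
  have "\<phi> \<in> Aut (ball 0 1)"
    by (rule AutI[OF open_ball holo holo maps maps involutive involutive])
  moreover have "\<phi> a = 0"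
  proof -
    have "ip a = (1 - S) * (1 + S)" unfolding ip_def aa by algebra
    then have "num a = 0" using S(2) by (simp add: num_def vec_eq_iff)
    then show ?thesis by (simp add: \<phi>_def)
  qed
  ultimately show ?thesis by blast
qed

section \<open>Compact orbit spaces\<close>

text \<open>The points that some automorphism moves to a place with a ball of radius more than
  \<open>1 / (m + 1)\<close> around it form an open set that is a union of orbits. The images of
  these sets are an open cover of the compact quotient, and the largest index in a finite subcover
  gives the radius.\<close>

lemma uniform_radius_of_compact_quotient:
  fixes \<Omega> :: "(complex ^ 'n::finite) set"
  assumes "open \<Omega>" "compact_space (Aut_quotient \<Omega>)"
  shows "\<exists>r>0. \<forall>x\<in>\<Omega>. \<exists>\<phi>\<in>Aut \<Omega>. ball (\<phi> x) r \<subseteq> \<Omega>"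
proof -
  define U where "U m = {x \<in> \<Omega>. \<exists>\<phi>\<in>Aut \<Omega>. \<exists>s > inverse (real (Suc m)). ball (\<phi> x) s \<subseteq> \<Omega>}" for m
  define V where "V m = Aut_orbit \<Omega> ` U m" for m
  have top: "topspace (Aut_quotient \<Omega>) = Aut_orbit \<Omega> ` \<Omega>"
    using quotient_imp_surjective_map[OF quotient_map_Aut_orbit[of \<Omega>]] by simp
  have id: "(\<lambda>x. x) \<in> Aut \<Omega>"
  proof (rule AutI[where f = "\<lambda>x. x" and g = "\<lambda>x. x", OF assms(1)])
    have "holo_on (\<lambda>x. x) \<Omega>" by (rule holo_onI_components) (rule cdiff_at_component)
    then show "holo_on (\<lambda>x. x) \<Omega>" and "holo_on (\<lambda>x. x) \<Omega>" by assumption+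
  qed simp_all
  have openU: "open (U m)" for m
    unfolding open_contains_ball
  proof
    fix x assume "x \<in> U m"
    then obtain \<phi> s where \<phi>: "x \<in> \<Omega>" "\<phi> \<in> Aut \<Omega>" "s > inverse (real (Suc m))" "ball (\<phi> x) s \<subseteq> \<Omega>"
      unfolding U_def by blast
    \<comment> \<open>An intermediate radius leaves room \<open>s - s'\<close> for
      \<open>\<phi> y\<close> to move when \<open>y\<close> varies near \<open>x\<close>.\<close>
    obtain s' where s': "inverse (real (Suc m)) < s'" "s' < s" using dense[OF \<phi>(3)] by blast
    have "continuous_on \<Omega> \<phi>" using \<phi>(2) by (simp add: Aut_def holo_on_imp_continuous_on)
    then obtain \<delta> where \<delta>: "\<delta> > 0" "\<And>y. y \<in> \<Omega> \<Longrightarrow> dist y x < \<delta> \<Longrightarrow> dist (\<phi> y) (\<phi> x) < s - s'"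
      using \<phi>(1) s' unfolding continuous_on_iff by (meson diff_gt_0_iff_gt)
    obtain \<delta>' where \<delta>': "\<delta>' > 0" "ball x \<delta>' \<subseteq> \<Omega>" using assms(1) \<phi>(1) open_contains_ball by blast
    have "ball x (min \<delta> \<delta>') \<subseteq> U m"
    proof
      fix y assume y: "y \<in> ball x (min \<delta> \<delta>')"
      then have "y \<in> \<Omega>" using \<delta>' by auto
      moreover have "ball (\<phi> y) s' \<subseteq> ball (\<phi> x) s"
        using \<delta>(2)[OF \<open>y \<in> \<Omega>\<close>] y by (intro ball_subset_ball_iff[THEN iffD2]) (auto simp: dist_commute)
      ultimately show "y \<in> U m" using \<phi>(2,4) s'(1) unfolding U_def by blast
    qed
    then show "\<exists>e>0. ball x e \<subseteq> U m" using \<delta>(1) \<delta>'(1) by (meson min_less_iff_conj)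
  qed
  have saturated: "{x \<in> \<Omega>. Aut_orbit \<Omega> x \<in> V m} = U m" for m
  proof
    have "U m \<subseteq> \<Omega>" unfolding U_def by blast
    then show "U m \<subseteq> {x \<in> \<Omega>. Aut_orbit \<Omega> x \<in> V m}" unfolding V_def by blast
    show "{x \<in> \<Omega>. Aut_orbit \<Omega> x \<in> V m} \<subseteq> U m"
    proof clarify
      fix x assume "x \<in> \<Omega>" "Aut_orbit \<Omega> x \<in> V m"
      then obtain y where y_orbit: "Aut_orbit \<Omega> x = Aut_orbit \<Omega> y" and "y \<in> U m"
        unfolding V_def by (elim imageE)
      from \<open>y \<in> U m\<close> obtain \<phi> s where y: "\<phi> \<in> Aut \<Omega>"
        "s > inverse (real (Suc m))" "ball (\<phi> y) s \<subseteq> \<Omega>"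
        unfolding U_def by blast
      \<comment> \<open>Equality of the orbits directly supplies an automorphism taking
        \<open>x\<close> to \<open>\<phi> y\<close>, so automorphisms need not be composed.\<close>
      have "\<phi> y \<in> Aut_orbit \<Omega> y" unfolding Aut_orbit_def using y(1) by (rule imageI)
      then obtain \<phi>' where \<phi>': "\<phi>' \<in> Aut \<Omega>" "\<phi> y = \<phi>' x"
        unfolding y_orbit[symmetric] unfolding Aut_orbit_def by (rule imageE)
      from y(3) have "ball (\<phi>' x) s \<subseteq> \<Omega>" by (simp only: \<phi>'(2))
      with \<open>x \<in> \<Omega>\<close> \<phi>'(1) y(2) show "x \<in> U m" unfolding U_def by blast
    qed
  qed
  have openV: "openin (Aut_quotient \<Omega>) (V m)" for m
    unfolding openin_Aut_quotient saturated openin_open_eq[OF assms(1)]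
  proof (intro conjI openU)
    show "U m \<subseteq> \<Omega>" unfolding U_def by blast
    then show "V m \<subseteq> Aut_orbit \<Omega> ` \<Omega>" unfolding V_def by blast
  qed
  have cover: "Aut_orbit \<Omega> ` \<Omega> \<subseteq> (\<Union>m. V m)"
  proof clarify
    fix x assume x: "x \<in> \<Omega>"
    then obtain \<delta> where \<delta>: "\<delta> > 0" "ball x \<delta> \<subseteq> \<Omega>" using assms(1) open_contains_ball by blast
    obtain m where "inverse (real (Suc m)) < \<delta>" using reals_Archimedean[OF \<delta>(1)] by auto
    with x \<delta>(2) have "x \<in> U m" unfolding U_def by (auto intro: bexI[OF _ id])
    then show "Aut_orbit \<Omega> x \<in> (\<Union>m. V m)" by (auto simp: V_def)
  qed
  have "compactin (Aut_quotient \<Omega>) (Aut_orbit \<Omega> ` \<Omega>)"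
    using assms(2) unfolding compact_space_def top .
  moreover have "\<forall>W\<in>range V. openin (Aut_quotient \<Omega>) W" using openV by blast
  ultimately obtain C where C: "finite C" "C \<subseteq> range V" "Aut_orbit \<Omega> ` \<Omega> \<subseteq> \<Union>C"
    using cover unfolding compactin_def by metis
  then obtain I where I: "finite I" "C = V ` I" using finite_subset_image by metis
  \<comment> \<open>The inserted 0 keeps \<open>Max\<close> meaningful if \<open>I\<close> is
    empty.\<close>
  define m where "m = Max (insert 0 I)"
  have "\<exists>\<phi>\<in>Aut \<Omega>. ball (\<phi> x) (inverse (real (Suc m))) \<subseteq> \<Omega>" if "x \<in> \<Omega>" for x
  proof -
    obtain j where "j \<in> I" "Aut_orbit \<Omega> x \<in> V j" using I(2) C(3) \<open>x \<in> \<Omega>\<close> by blast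
    then have "x \<in> U j" using saturated \<open>x \<in> \<Omega>\<close> by blast
    then obtain \<phi> s where "\<phi> \<in> Aut \<Omega>" "inverse (real (Suc j)) < s" "ball (\<phi> x) s \<subseteq> \<Omega>"
      unfolding U_def by blast
    moreover have "inverse (real (Suc m)) \<le> inverse (real (Suc j))"
      using \<open>j \<in> I\<close> I(1) by (simp add: m_def)
    ultimately have "ball (\<phi> x) (inverse (real (Suc m))) \<subseteq> \<Omega>"
      using subset_ball[of "inverse (real (Suc m))" s "\<phi> x"] by (meson less_imp_le order_trans)
    with \<open>\<phi> \<in> Aut \<Omega>\<close> show ?thesis by blast
  qed
  then show ?thesis by (intro exI[of _ "inverse (real (Suc m))"]) simp
qed

section \<open>A quantitative Liouville theorem\<close>

lemma quantitative_Liouville: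
  fixes F :: "complex set" and a b :: complex and B e :: real
  assumes F: "finite F" "a \<notin> F" "b \<notin> F" and e: "e > 0"
  obtains K where "compact K" "K \<inter> F = {}" "a \<in> K" "b \<in> K"
    and "\<And>D h. open D \<Longrightarrow> K \<subseteq> D \<Longrightarrow> h holomorphic_on D \<Longrightarrow> (\<And>z. z \<in> D \<Longrightarrow> cmod (h z) \<le> B) \<Longrightarrow>
           cmod (h b - h a) \<le> e \<and> cmod (deriv h a) \<le> e"
proof -
  \<comment> \<open>Let \<open>k\<close> be the difference quotient of \<open>h\<close> at \<open>a\<close> and \<open>K\<close> a disc of radius \<open>R\<close> with discs of
    radius \<open>\<epsilon>\<close> around \<open>F\<close> removed. By the maximum principle for \<open>k ^ (d + 1) * Q\<close>, where \<open>d = card F\<close>,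
    it suffices to bound this product on the frontier of \<open>K\<close>. It is \<open>O(1 / R)\<close> on the large circle
    and, once \<open>R\<close> is fixed, \<open>O(\<epsilon>)\<close> on the small ones.\<close>
  define Q where "Q z = (\<Prod>f\<in>F. z - f)" for z
  define d where "d = card F"
  \<comment> \<open>A bound \<open>e'\<close> on the difference quotient then serves both the
    derivative and the increment from \<open>a\<close> to \<open>b\<close>.\<close>
  define e' where "e' = e / (1 + cmod (b - a))"
  define c where "c = min (cmod (Q a)) (cmod (Q b))"
  \<comment> \<open>The bound wanted for \<open>k ^ (d + 1) * Q\<close>: at \<open>a\<close> and
    \<open>b\<close>, where \<open>|Q|\<close> is at least \<open>c\<close>, it gives
    \<open>|k| \<le> e'\<close>.\<close>
  define \<eta> where "\<eta> = e' ^ Suc d * c"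
  define B' where "B' = max B 1"
  have "1 + cmod (b - a) > 0" by (simp add: add_pos_nonneg)
  then have e': "e' > 0" "e' \<le> e" "e' * cmod (b - a) \<le> e"
    using e by (simp_all add: e'_def field_simps)
  have "Q a \<noteq> 0" "Q b \<noteq> 0" using F by (auto simp: Q_def)
  then have c: "c > 0" by (simp add: c_def)
  with e' have \<eta>: "\<eta> > 0" by (simp add: \<eta>_def)
  obtain \<rho> where \<rho>: "\<rho> > 0" "\<And>f. f \<in> F \<Longrightarrow> \<rho> \<le> dist a f" "\<And>f. f \<in> F \<Longrightarrow> \<rho> \<le> dist b f"
  proof -
    from finite_set_avoid[OF F(1), of a] finite_set_avoid[OF F(1), of b] obtain p q
      where p: "p > 0" "\<forall>x\<in>F. x \<noteq> a \<longrightarrow> p \<le> dist a x" and q: "q > 0" "\<forall>x\<in>F. x \<noteq> b \<longrightarrow> q \<le> dist b x"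
      by blast
    show ?thesis
    proof (rule that[of "min p q"])
      show "min p q > 0" using p q by simp
      show "min p q \<le> dist a f" if "f \<in> F" for f
        using p(2) that F(2) by (metis min.coboundedI1)
      show "min p q \<le> dist b f" if "f \<in> F" for f
        using q(2) that F(3) by (metis min.coboundedI2)
    qed
  qed
  define \<sigma> where "\<sigma> = (\<Sum>f\<in>F. cmod f)"
  have \<sigma>: "\<sigma> \<ge> 0" "\<And>f. f \<in> F \<Longrightarrow> cmod f \<le> \<sigma>"
    unfolding \<sigma>_def using F(1) by (auto intro: sum_nonneg member_le_sum)
  \<comment> \<open>The first entry keeps \<open>a\<close>, \<open>b\<close> and \<open>F\<close>
    well inside the large circle, with distance at least \<open>R / 2\<close> from \<open>a\<close>
    to it. The second makes the bound on that circle at most \<eta>.\<close>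
  define R where "R = max (2 * (1 + cmod a + cmod b + \<sigma>)) ((4 * B') ^ Suc d * 2 ^ d / \<eta>)"
  have R_ge: "2 * (1 + cmod a + cmod b + \<sigma>) \<le> R" by (simp add: R_def)
  then have R: "R > 0 \<and> 2 * cmod a \<le> R \<and> cmod a < R \<and> cmod b < R"
    using \<sigma>(1) norm_ge_zero[of a] norm_ge_zero[of b] by (intro conjI; argo)
  have RF: "cmod f \<le> R" if "f \<in> F" for f
    using R_ge \<sigma>(1) \<sigma>(2)[OF that] norm_ge_zero[of a] norm_ge_zero[of b] by argo
  have "(4 * B') ^ Suc d * 2 ^ d / \<eta> \<le> R" by (simp add: R_def)
  then have R2: "(4 * B') ^ Suc d * 2 ^ d \<le> \<eta> * R" using \<eta> by (simp add: field_simps)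
  \<comment> \<open>On a small circle one factor of \<open>Q\<close> has modulus \<epsilon>. The
    other \<open>d - 1\<close> factors are at most \<open>2 * R\<close>, so the product is at most
    \<open>X * \<epsilon>\<close> there.\<close>
  define X where "X = (4 * B' / \<rho>) ^ Suc d * (2 * R) ^ (d - 1)"
  have X: "X > 0" using R \<rho>(1) by (simp add: X_def B'_def)
  \<comment> \<open>The bound \<open>\<rho> / 2\<close> keeps \<open>a\<close> and \<open>b\<close>
    outside the removed discs and the small circles at distance at least \<open>\<rho> / 2\<close>
    from \<open>a\<close>.\<close>
  define \<epsilon> where "\<epsilon> = min (\<rho> / 2) (\<eta> / X)"
  have \<epsilon>: "\<epsilon> > 0" "\<epsilon> \<le> \<rho> / 2" "X * \<epsilon> \<le> \<eta>"
    using \<rho>(1) \<eta> X by (auto simp: \<epsilon>_def min_def field_simps)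

  define K where "K = cball 0 R - (\<Union>f\<in>F. ball f \<epsilon>)"
  have compact: "compact K" unfolding K_def by (intro compact_diff compact_cball open_UN ballI open_ball)
  have disj: "K \<inter> F = {}" using \<epsilon>(1) by (auto simp: K_def)
  have aK: "a \<in> K" and bK: "b \<in> K"
    using R \<rho> \<epsilon> by (force simp: K_def dist_commute)+
  have front: "cmod z = R \<or> (\<exists>f\<in>F. cmod (z - f) = \<epsilon>)" "z \<in> K" if "z \<in> frontier K" for z
  proof -
    show z: "z \<in> K" using that compact frontier_subset_compact by blast
    show "cmod z = R \<or> (\<exists>f\<in>F. cmod (z - f) = \<epsilon>)"
    proof (rule ccontr)
      assume neg: "\<not> ?thesis"
      define U where "U = ball 0 R - (\<Union>f\<in>F. cball f \<epsilon>)"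
      have "open U" unfolding U_def using F(1) by (intro open_Diff open_ball closed_UN ballI closed_cball)
      moreover have "U \<subseteq> K" by (force simp: U_def K_def)
      moreover have "z \<in> U"
        using z neg by (force simp: U_def K_def dist_norm norm_minus_commute)
      ultimately have "z \<in> interior K" by (blast intro: interiorI)
      with that show False by (simp add: frontier_def)
    qed
  qed
  show ?thesis
  proof (rule that[OF compact disj aK bK])
    fix D h assume D: "open D" "K \<subseteq> D" "h holomorphic_on D" and "\<And>z. z \<in> D \<Longrightarrow> cmod (h z) \<le> B"
    then have hB: "cmod (h z) \<le> B'" if "z \<in> K" for z
      using that by (force simp: B'_def)
    \<comment> \<open>With the derivative as its value at \<open>a\<close>, the difference quotient
      is holomorphic across \<open>a\<close>, and \<open>k a\<close> controls
      \<open>deriv h a\<close>.\<close>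
    define k where "k z = (if z = a then deriv h a else (h z - h a) / (z - a))" for z
    have holk: "k holomorphic_on D"
      unfolding k_def using D aK by (intro pole_lemma) (auto simp: interior_open)
    define G where "G z = k z ^ Suc d * Q z" for z
    have holG: "G holomorphic_on D"
      unfolding G_def Q_def by (intro holomorphic_intros holk)
    have kle: "cmod (k z) \<le> 2 * B' / r" if "z \<in> K" "r > 0" "cmod (z - a) \<ge> r" for z r
    proof -
      have "cmod (h z - h a) \<le> 2 * B'"
        using norm_triangle_ineq4[of "h z" "h a"] hB[OF that(1)] hB[OF aK] by linarith
      moreover have "z \<noteq> a" using that by auto
      ultimately show ?thesis
        using that unfolding k_def by (simp add: norm_divide frac_le B'_def)
    qed
    have Qfactor: "cmod (z - f) \<le> 2 * R" if "z \<in> K" "f \<in> F" for z f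
    proof -
      have "cmod z \<le> R" using that by (simp add: K_def)
      then show ?thesis using norm_triangle_ineq4[of z f] RF[OF that(2)] by linarith
    qed
    have bound: "cmod (G z) \<le> \<eta>" if "z \<in> K" for z
    proof (rule maximum_modulus_frontier[of G K])
      show "G holomorphic_on interior K"
        using holG D(2) interior_subset by (blast intro: holomorphic_on_subset)
      show "continuous_on (closure K) G"
        using holG D(2) compact by (simp add: compact_imp_closed holomorphic_on_imp_continuous_on[THEN continuous_on_subset])
      show "bounded K" using compact by (rule compact_imp_bounded)
      fix z assume "z \<in> frontier K"
      note zK = front(2)[OF this] and cases = front(1)[OF this]
      from cases show "cmod (G z) \<le> \<eta>"
      proof
        assume z: "cmod z = R"
        have "cmod (z - a) \<ge> R / 2" using norm_triangle_ineq2[of z a] z R by linarith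
        then have "cmod (k z) \<le> 4 * B' / R" using kle[OF zK, of "R / 2"] R by simp
        moreover have "cmod (Q z) \<le> (2 * R) ^ d"
          unfolding Q_def prod_norm[symmetric] d_def
          using prod_mono[of F "\<lambda>f. cmod (z - f)" "\<lambda>_. 2 * R"] Qfactor[OF zK] by simp
        ultimately have "cmod (G z) \<le> (4 * B' / R) ^ Suc d * (2 * R) ^ d"
          unfolding G_def norm_mult norm_power using R
          by (intro mult_mono power_mono) (auto simp: B'_def)
        \<comment> \<open>The power of \<open>k\<close> exceeds the degree of \<open>Q\<close> by
          one, which leaves a single factor \<open>1 / R\<close>.\<close>
        also have "\<dots> = (4 * B') ^ Suc d * 2 ^ d / R"
          using R by (simp add: power_divide power_mult_distrib)
        also have "\<dots> \<le> \<eta>" using R2 R by (simp add: field_simps)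
        finally show ?thesis .
      next
        assume "\<exists>f\<in>F. cmod (z - f) = \<epsilon>"
        then obtain f where f: "f \<in> F" "cmod (z - f) = \<epsilon>" by blast
        have "\<rho> \<le> dist a f" using \<rho>(2) f(1) .
        then have "cmod (z - a) \<ge> \<rho> / 2"
          using norm_triangle_ineq4[of "z - f" "z - a"] f(2) \<epsilon>(2) by (simp add: dist_norm)
        then have "cmod (k z) \<le> 4 * B' / \<rho>" using kle[OF zK, of "\<rho> / 2"] \<rho>(1) by simp
        moreover have "cmod (Q z) \<le> \<epsilon> * (2 * R) ^ (d - 1)"
        proof -
          have "cmod (Q z) = cmod (z - f) * (\<Prod>g\<in>F - {f}. cmod (z - g))"
            unfolding Q_def prod_norm[symmetric] using F(1) f(1) by (rule prod.remove)
          also have "\<dots> \<le> \<epsilon> * (2 * R) ^ (d - 1)"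
            unfolding f(2) using prod_mono[of "F - {f}" "\<lambda>g. cmod (z - g)" "\<lambda>_. 2 * R"] Qfactor[OF zK] \<epsilon>(1) F(1) f(1)
            by (intro mult_left_mono) (auto simp: d_def)
          finally show ?thesis .
        qed
        ultimately have "cmod (G z) \<le> (4 * B' / \<rho>) ^ Suc d * (\<epsilon> * (2 * R) ^ (d - 1))"
          unfolding G_def norm_mult norm_power using \<rho>(1)
          by (intro mult_mono power_mono) (auto simp: B'_def)
        also have "\<dots> = X * \<epsilon>" by (simp add: X_def mult_ac)
        finally show ?thesis using \<epsilon>(3) by linarith
      qed
    qed (fact that)
    have k_small: "cmod (k z) \<le> e'" if "z \<in> K" "c \<le> cmod (Q z)" for z
    proof -
      have "cmod (k z) ^ Suc d * c \<le> cmod (k z) ^ Suc d * cmod (Q z)"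
        using that(2) by (intro mult_left_mono) auto
      also have "\<dots> \<le> e' ^ Suc d * c"
        using bound[OF that(1)] unfolding G_def norm_mult norm_power \<eta>_def .
      finally have "cmod (k z) ^ Suc d \<le> e' ^ Suc d" using c by simp
      then show ?thesis by (rule power_le_imp_le_base) (use e'(1) in simp)
    qed
    have "cmod (deriv h a) \<le> e"
      using k_small[OF aK] e'(2) by (simp add: k_def c_def)
    moreover have "cmod (h b - h a) \<le> e"
    proof -
      have "h b - h a = k b * (b - a)" by (simp add: k_def)
      then have "cmod (h b - h a) = cmod (k b) * cmod (b - a)" by (simp add: norm_mult)
      also have "\<dots> \<le> e' * cmod (b - a)"
        using k_small[OF bK] by (intro mult_right_mono) (auto simp: c_def)
      finally show ?thesis using e'(3) by linarith
    qed
    ultimately show "cmod (h b - h a) \<le> e \<and> cmod (deriv h a) \<le> e" by blast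
  qed
qed

section \<open>Affine lines in projective space\<close>

text \<open>The representative of \<open>chart_inv i x\<close> whose coordinate \<open>i\<close> is
  1. Lines in the chart lift to affine lines of such vectors.\<close>

definition homog :: "'n::finite option \<Rightarrow> complex ^ 'n \<Rightarrow> complex ^ 'n option" where
  "homog i x = (\<chi> j. case Transposition.transpose None i j of None \<Rightarrow> 1 | Some k \<Rightarrow> x $ k)"

text \<open>The lift of a direction has 0 at coordinate \<open>i\<close>, since that coordinate is
  constant on the lifted line.\<close>

definition homog_dir :: "'n::finite option \<Rightarrow> complex ^ 'n \<Rightarrow> complex ^ 'n option" where
  "homog_dir i v = (\<chi> j. case Transposition.transpose None i j of None \<Rightarrow> 0 | Some k \<Rightarrow> v $ k)"

lemma chart_inv_homog: "chart_inv i x = proj (homog i x)"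
  by (simp add: chart_inv_def homog_def)

lemma homog_line: "homog i (x + t *s v) = homog i x + t *s homog_dir i v"
  by (simp add: homog_def homog_dir_def vec_eq_iff split: option.split)

lemma homog_nonzero: "homog i x \<noteq> 0"
proof
  assume "homog i x = 0"
  then have "homog i x $ i = 0" by simp
  then show False by (simp add: homog_def)
qed

lemma continuous_on_homog: "continuous_on A (homog i)"
  unfolding homog_def
proof (rule continuous_on_vec_lambda)
  show "continuous_on A (\<lambda>x. case Transposition.transpose None i j of None \<Rightarrow> 1 | Some k \<Rightarrow> x $ k)" for j
    by (cases "Transposition.transpose None i j") (simp_all add: continuous_on_component)
qed

text \<open>Openness in projective space is defined by nonzero representatives, so it can be pulled
  back along the continuous lift \<open>homog i\<close>.\<close>

lemma open_chart_inv_preimage: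
  assumes "open N"
  shows "open {x. chart_inv i x \<in> N}"
proof -
  have "{x. chart_inv i x \<in> N} = homog i -` {z. z \<noteq> 0 \<and> proj z \<in> N}"
    by (auto simp: chart_inv_homog homog_nonzero)
  moreover have "open (homog i -` {z. z \<noteq> 0 \<and> proj z \<in> N})"
    using assms continuous_on_homog by (intro open_vimage) (simp_all add: open_cproj_def)
  ultimately show ?thesis by simp
qed

lemma open_line_preimage:
  assumes "open N"
  shows "open {t. chart_inv i (x + t *s v) \<in> N}"
proof -
  have "open ((\<lambda>t. x + t *s v) -` {x. chart_inv i x \<in> N})"
    using open_chart_inv_preimage[OF assms]
    by (intro open_vimage continuous_intros bounded_linear.continuous_on[OF bounded_linear_smult_left])
  then show ?thesis by (simp add: vimage_def)
qed

section \<open>Forms and quasiprojective sets on lines\<close>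

lemma homogeneous_form_on_line:
  assumes "homogeneous_form d P"
  shows "\<exists>p. \<forall>t. P (z + t *s w) = poly p t"
proof -
  obtain c where c: "P = (\<lambda>z. \<Sum>\<alpha>\<in>{\<alpha>. sum \<alpha> UNIV = d}. c \<alpha> * (\<Prod>i\<in>UNIV. z $ i ^ \<alpha> i))"
    using assms unfolding homogeneous_form_def by blast
  show ?thesis
    by (rule exI[of _ "\<Sum>\<alpha>\<in>{\<alpha>. sum \<alpha> UNIV = d}. smult (c \<alpha>) (\<Prod>i\<in>UNIV. [:z $ i, w $ i:] ^ \<alpha> i)"])
       (simp add: c poly_sum poly_prod poly_power)
qed

lemma homogeneous_form_smult:
  assumes "homogeneous_form d P"
  shows "P (c *s z) = c ^ d * P z"
proof -
  obtain a where a: "P = (\<lambda>z. \<Sum>\<alpha>\<in>{\<alpha>. sum \<alpha> UNIV = d}. a \<alpha> * (\<Prod>i\<in>UNIV. z $ i ^ \<alpha> i))"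
    using assms unfolding homogeneous_form_def by blast
  have "(\<Prod>i\<in>UNIV. (c * z $ i) ^ \<alpha> i) = c ^ d * (\<Prod>i\<in>UNIV. z $ i ^ \<alpha> i)" if "sum \<alpha> UNIV = d" for \<alpha>
    using that by (simp add: power_mult_distrib prod.distrib flip: power_sum)
  then show ?thesis unfolding a by (simp add: sum_distrib_left mult.left_commute)
qed

text \<open>Homogeneity makes vanishing independent of the representative, so membership can be
  tested on any given one.\<close>

lemma proj_mem_zero_locus:
  assumes "\<forall>P\<in>S. \<exists>d. homogeneous_form d P" "z \<noteq> 0"
  shows "proj z \<in> {proj z | z. z \<noteq> 0 \<and> (\<forall>P\<in>S. P z = 0)} \<longleftrightarrow> (\<forall>P\<in>S. P z = 0)"
proof
  assume "proj z \<in> {proj z | z. z \<noteq> 0 \<and> (\<forall>P\<in>S. P z = 0)}"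
  then obtain w where w: "w \<noteq> 0" "proj w = proj z" "\<forall>P\<in>S. P w = 0" by auto
  then obtain c where c: "z = c *s w" using proj_eq_iff assms(2) by blast
  show "\<forall>P\<in>S. P z = 0"
  proof
    fix P assume "P \<in> S"
    moreover from this obtain d where "homogeneous_form d P" using assms(1) by blast
    ultimately show "P z = 0" using w(3) by (simp add: c homogeneous_form_smult)
  qed
qed (use assms(2) in blast)

text \<open>On a line through a point of \<open>M = Z - W\<close>, the forms that define \<open>Z\<close> vanish near that point,
  hence on the whole line, and some form that defines \<open>W\<close> has only finitely many zeros.\<close>

lemma finite_line_complement:
  fixes M :: "'n::finite cproj set"
  assumes "quasiprojective M" "open M" "chart_inv i x \<in> M"
  shows "finite {t. chart_inv i (x + t *s v) \<notin> M}"
proof -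
  define L where "L t = homog i x + t *s homog_dir i v" for t
  have L: "chart_inv i (x + t *s v) = proj (L t)" "L t \<noteq> 0" for t
    using homog_nonzero[of i "x + t *s v"] by (simp_all add: chart_inv_homog homog_line L_def)
  obtain S T where S: "\<forall>P\<in>S. \<exists>d. homogeneous_form d P" and T: "\<forall>P\<in>T. \<exists>d. homogeneous_form d P"
    and M: "M = {proj z | z. z \<noteq> 0 \<and> (\<forall>P\<in>S. P z = 0)} - {proj z | z. z \<noteq> 0 \<and> (\<forall>P\<in>T. P z = 0)}"
    using assms(1) unfolding quasiprojective_def zariski_closed_def by blast
  have LM: "proj (L t) \<in> M \<longleftrightarrow> (\<forall>P\<in>S. P (L t) = 0) \<and> \<not> (\<forall>P\<in>T. P (L t) = 0)" for t
    unfolding M Diff_iff proj_mem_zero_locus[OF S L(2)] proj_mem_zero_locus[OF T L(2)] ..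
  have M0: "proj (L 0) \<in> M" using assms(3) L(1)[of 0] by simp
  then obtain Q where Q: "Q \<in> T" "Q (L 0) \<noteq> 0" using LM by blast
  obtain q where q: "\<And>t. Q (L t) = poly q t"
    using T Q(1) homogeneous_form_on_line unfolding L_def by metis
  have "q \<noteq> 0" using Q(2) q[of 0] by auto
  have "P (L t) = 0" if P: "P \<in> S" for P t
  proof -
    obtain p where p: "\<And>t. P (L t) = poly p t"
      using S P homogeneous_form_on_line unfolding L_def by metis
    have "open {t. proj (L t) \<in> M}" using open_line_preimage[OF assms(2), of i x v] by (simp add: L(1))
    \<comment> \<open>A nonempty open set of parameters is infinite, which forces the polynomial
      \<open>p\<close> to be zero.\<close>
    then have "infinite {t. proj (L t) \<in> M}" using M0 finite_imp_not_open by blast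
    then have "infinite {t. poly p t = 0}"
      by (rule infinite_super[rotated]) (use LM P p in auto)
    then have "p = 0" using poly_roots_finite by blast
    then show ?thesis by (simp add: p)
  qed
  then have "{t. chart_inv i (x + t *s v) \<notin> M} \<subseteq> {t. poly q t = 0}"
    using LM Q(1) q by (auto simp: L(1))
  then show ?thesis using poly_roots_finite[OF \<open>q \<noteq> 0\<close>] finite_subset by blast
qed

section \<open>Discs in a union of increasing open sets\<close>

text \<open>Supplies the competing discs: an affine disc inside the ball of radius \<open>r\<close>,
  carried into \<open>M\<close> by \<open>G\<close>.\<close>

lemma holo_disc_affine:
  assumes "holo_to_proj G \<Omega>" "G ` \<Omega> \<subseteq> M" "ball y r \<subseteq> \<Omega>" "norm u < r"
  shows "holo_disc M (\<lambda>z. G (y + z *s u))"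
proof -
  have in_\<Omega>: "y + z *s u \<in> \<Omega>" if "z \<in> ball 0 1" for z
  proof -
    have "norm (z *s u) \<le> norm u"
      using that by (simp add: norm_vector_smult mult_left_le_one_le)
    then have "y + z *s u \<in> ball y r" using assms(4) by (simp add: dist_norm)
    then show ?thesis using assms(3) by blast
  qed
  have "continuous_on (ball 0 1) (\<lambda>z. G (y + z *s u))"
  proof (rule continuous_on_compose2[of _ G])
    show "continuous_on \<Omega> G" using assms(1) by (simp add: holo_to_proj_def)
    show "continuous_on (ball 0 1) (\<lambda>z. y + z *s u)"
      by (intro continuous_intros bounded_linear.continuous_on[OF bounded_linear_smult_left])
  qed (use in_\<Omega> in blast)
  moreover have "(\<lambda>z. chart i (G (y + z *s u)) $ k) holomorphic_on
      {z \<in> ball 0 1. chart_dom i (G (y + z *s u))}" for i k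
    unfolding holomorphic_on_def
  proof
    fix z assume "z \<in> {z \<in> ball 0 1. chart_dom i (G (y + z *s u))}"
    then have "y + z *s u \<in> {x \<in> \<Omega>. chart_dom i (G x)}" using in_\<Omega> by blast
    with assms(1) obtain D where "((\<lambda>x. chart i (G x)) has_derivative D) (at (y + z *s u))"
      and "\<And>c v. D (c *s v) = c *s D v"
      unfolding holo_to_proj_def by (meson holo_onE)
    then have "((\<lambda>z. chart i (G (y + z *s u)) $ k) has_field_derivative D u $ k) (at z)"
      by (intro has_field_derivative_component has_derivative_along_line)
    then show "(\<lambda>z. chart i (G (y + z *s u)) $ k) field_differentiable
        at z within {z \<in> ball 0 1. chart_dom i (G (y + z *s u))}"
      using field_differentiable_at_within field_differentiable_def by blast
  qed
  ultimately show ?thesis using assms(2) in_\<Omega> unfolding holo_disc_def by blast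
qed

text \<open>The inverse of the given parametrization is followed by an automorphism that moves the
  image of \<open>p\<close> to a point with room \<open>r\<close> around it.\<close>

lemma normalized_coordinates:
  assumes "biholomorphic_to_proj \<Omega> N" "p \<in> N"
    and "\<forall>x\<in>\<Omega>. \<exists>\<phi>\<in>Aut \<Omega>. ball (\<phi> x) r \<subseteq> \<Omega>"
  obtains G g where "holo_to_proj G \<Omega>" "G ` \<Omega> \<subseteq> N" "holo_from_proj g N" "g ` N \<subseteq> \<Omega>"
    "\<And>q. q \<in> N \<Longrightarrow> G (g q) = q" "ball (g p) r \<subseteq> \<Omega>"
proof -
  obtain f where f: "bij_betw f \<Omega> N" "holo_to_proj f \<Omega>" "holo_from_proj (inv_into \<Omega> f) N"
    using assms(1) unfolding biholomorphic_to_proj_def by blast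
  define h where "h = inv_into \<Omega> f"
  have h: "h q \<in> \<Omega>" "f (h q) = q" if "q \<in> N" for q
    using that f(1) unfolding h_def bij_betw_def by (auto intro: inv_into_into f_inv_into_f)
  obtain \<phi> where \<phi>: "\<phi> \<in> Aut \<Omega>" "ball (\<phi> (h p)) r \<subseteq> \<Omega>" using assms(2,3) h(1) by blast
  define \<psi> where "\<psi> = inv_into \<Omega> \<phi>"
  have holo: "holo_on \<phi> \<Omega>" "holo_on \<psi> \<Omega>" and bij: "bij_betw \<phi> \<Omega> \<Omega>"
    using \<phi>(1) by (simp_all add: Aut_def \<psi>_def)
  have \<phi>\<psi>: "\<phi> x \<in> \<Omega>" "\<psi> x \<in> \<Omega>" "\<psi> (\<phi> x) = x" if "x \<in> \<Omega>" for x
    using that bij unfolding \<psi>_def bij_betw_def by (auto intro: inv_into_into)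
  show ?thesis
  proof (rule that[of "\<lambda>x. f (\<psi> x)" "\<lambda>q. \<phi> (h q)"])
    have "continuous_on \<Omega> (\<lambda>x. f (\<psi> x))"
    proof (rule continuous_on_compose2[of _ f])
      show "continuous_on \<Omega> f" using f(2) by (simp add: holo_to_proj_def)
      show "continuous_on \<Omega> \<psi>" using holo(2) by (rule holo_on_imp_continuous_on)
    qed (use \<phi>\<psi>(2) in blast)
    moreover have "holo_on (\<lambda>x. chart i (f (\<psi> x))) {x \<in> \<Omega>. chart_dom i (f (\<psi> x))}" for i
    proof (rule holo_on_compose[of \<psi>])
      show "holo_on (\<lambda>x. chart i (f x)) {x \<in> \<Omega>. chart_dom i (f x)}"
        using f(2) by (simp add: holo_to_proj_def)
      show "holo_on \<psi> {x \<in> \<Omega>. chart_dom i (f (\<psi> x))}"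
        using holo(2) by (rule holo_on_subset) blast
    qed (use \<phi>\<psi>(2) in blast)
    ultimately show "holo_to_proj (\<lambda>x. f (\<psi> x)) \<Omega>" by (simp add: holo_to_proj_def)
    show "holo_from_proj (\<lambda>q. \<phi> (h q)) N"
      unfolding holo_from_proj_def
    proof
      fix i
      show "holo_on (\<lambda>x. \<phi> (h (chart_inv i x))) {x. chart_inv i x \<in> N}"
      proof (rule holo_on_compose[OF _ holo(1)])
        show "holo_on (\<lambda>x. h (chart_inv i x)) {x. chart_inv i x \<in> N}"
          using f(3) by (simp add: holo_from_proj_def h_def)
      qed (use h(1) in blast)
    qed
    show "(\<lambda>x. f (\<psi> x)) ` \<Omega> \<subseteq> N" using \<phi>\<psi>(2) f(1) by (auto simp: bij_betw_def)
    show "(\<lambda>q. \<phi> (h q)) ` N \<subseteq> \<Omega>" using \<phi>\<psi>(1) h(1) by blast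
    show "f (\<psi> (\<phi> (h q))) = q" if "q \<in> N" for q using that h \<phi>\<psi>(3) by simp
    show "ball (\<phi> (h p)) r \<subseteq> \<Omega>" by (fact \<phi>(2))
  qed
qed

text \<open>The compact set from the Liouville estimate depends only on the line, \<open>b\<close>,
  \<open>e\<close> and a bound for \<open>\<Omega>\<close>, and by compactness it lies in one
  \<open>N j\<close>. Hence \<open>j\<close> is chosen before \<open>g\<close>. This order matters
  because the normalized coordinate \<open>g\<close> is available only once \<open>j\<close> is
  known.\<close>

lemma exhaustion_line_nearly_constant:
  fixes M :: "'n::finite cproj set" and \<Omega> :: "(complex ^ 'n) set"
  assumes "quasiprojective M" "\<And>j. open (N j)" "incseq N" "M = (\<Union>j. N j)" "bounded \<Omega>"
    and "chart_inv i x \<in> M" "chart_inv i (x + b *s v) \<in> M" "e > 0"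
  obtains j where "chart_inv i x \<in> N j" "chart_inv i (x + b *s v) \<in> N j"
    "\<And>g. holo_from_proj g (N j) \<Longrightarrow> g ` N j \<subseteq> \<Omega> \<Longrightarrow>
       norm (g (chart_inv i (x + b *s v)) - g (chart_inv i x)) \<le> e \<and>
       (\<exists>w. ((\<lambda>t. g (chart_inv i (x + t *s v))) has_derivative (\<lambda>c. c *s w)) (at 0) \<and> norm w \<le> e)"
proof -
  define F where "F = {t. chart_inv i (x + t *s v) \<notin> M}"
  define D where "D j = {t. chart_inv i (x + t *s v) \<in> N j}" for j
  \<comment> \<open>The Liouville estimate is applied to each component, and the norm is at most the
    sum of the component moduli.\<close>
  define e' where "e' = e / real (CARD('n))"
  obtain B where B: "\<And>y. y \<in> \<Omega> \<Longrightarrow> norm y \<le> B" using assms(5) unfolding bounded_iff by blast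
  have "open M" using assms(2,4) by auto
  then have "finite F" unfolding F_def by (intro finite_line_complement assms(1,6))
  moreover have "0 \<notin> F" "b \<notin> F" using assms(6,7) by (simp_all add: F_def)
  moreover have "e' > 0" using assms(8) by (simp add: e'_def)
  ultimately obtain K where K: "compact K" "K \<inter> F = {}" "0 \<in> K" "b \<in> K"
    and small: "\<And>D h. open D \<Longrightarrow> K \<subseteq> D \<Longrightarrow> h holomorphic_on D \<Longrightarrow> (\<And>z. z \<in> D \<Longrightarrow> cmod (h z) \<le> B) \<Longrightarrow>
           cmod (h b - h 0) \<le> e' \<and> cmod (deriv h 0) \<le> e'"
    using quantitative_Liouville[of F 0 b e' B] by metis
  have openD: "open (D j)" for j unfolding D_def by (intro open_line_preimage assms(2))
  have "K \<subseteq> (\<Union>j. D j)" using K(2) assms(4) by (auto simp: F_def D_def)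
  then obtain I where I: "finite I" "K \<subseteq> (\<Union>j\<in>I. D j)"
    using compactE_image[OF K(1), of UNIV D] openD by auto
  define j where "j = Max (insert 0 I)"
  have "D l \<subseteq> D j" if "l \<in> I" for l
  proof -
    have "l \<le> j" using I(1) that by (simp add: j_def)
    then have "N l \<subseteq> N j" using assms(3) by (rule incseqD[rotated])
    then show ?thesis by (auto simp: D_def)
  qed
  then have KD: "K \<subseteq> D j" using I(2) by blast
  show ?thesis
  proof (rule that)
    show "chart_inv i x \<in> N j" "chart_inv i (x + b *s v) \<in> N j" using KD K(3,4) by (auto simp: D_def)
  next
    fix g assume g: "holo_from_proj g (N j)" "g ` N j \<subseteq> \<Omega>"
    define H where "H t = g (chart_inv i (x + t *s v))" for t
    have der: "\<exists>w. (H has_derivative (\<lambda>c. c *s w)) (at t)" if "t \<in> D j" for t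
    proof -
      have "x + t *s v \<in> {x. chart_inv i x \<in> N j}" using that by (simp add: D_def)
      with g(1) obtain E where "((\<lambda>x. g (chart_inv i x)) has_derivative E) (at (x + t *s v))"
        and "\<And>c v. E (c *s v) = c *s E v"
        unfolding holo_from_proj_def by (meson holo_onE)
      from has_derivative_along_line[OF this] show ?thesis unfolding H_def by blast
    qed
    have component: "cmod (H b $ k - H 0 $ k) \<le> e' \<and> cmod (deriv (\<lambda>t. H t $ k) 0) \<le> e'" for k
    proof (rule small[OF openD KD])
      show "(\<lambda>t. H t $ k) holomorphic_on D j"
        unfolding holomorphic_on_def
      proof
        fix t assume "t \<in> D j"
        from der[OF this] show "(\<lambda>t. H t $ k) field_differentiable at t within D j"
          using has_field_derivative_component field_differentiable_at_within field_differentiable_def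
          by blast
      qed
      show "cmod (H t $ k) \<le> B" if "t \<in> D j" for t
      proof -
        have "H t \<in> \<Omega>" using that g(2) by (auto simp: H_def D_def)
        then show ?thesis using B Finite_Cartesian_Product.norm_nth_le order_trans by blast
      qed
    qed
    have norm_small: "norm u \<le> e" if "\<And>k. cmod (u $ k) \<le> e'" for u :: "complex ^ 'n"
    proof -
      have "norm u \<le> (\<Sum>k\<in>(UNIV :: 'n set). e')"
        by (rule order_trans[OF norm_le_sum_components sum_mono]) (rule that)
      then show ?thesis by (simp add: e'_def)
    qed
    obtain w where w: "(H has_derivative (\<lambda>c. c *s w)) (at 0)" using der KD K(3) by blast
    have "deriv (\<lambda>t. H t $ k) 0 = w $ k" for k
      using has_field_derivative_component[OF w] by (rule DERIV_imp_deriv)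
    then have "norm w \<le> e" using component by (intro norm_small) simp
    moreover have "norm (H b - H 0) \<le> e" using component by (intro norm_small) simp
    ultimately show "norm (g (chart_inv i (x + b *s v)) - g (chart_inv i x)) \<le> e \<and>
       (\<exists>w. ((\<lambda>t. g (chart_inv i (x + t *s v))) has_derivative (\<lambda>c. c *s w)) (at 0) \<and> norm w \<le> e)"
      using w by (simp add: H_def[abs_def]) blast
  qed
qed

section \<open>Vanishing of the Kobayashi distance and metric\<close>

text \<open>For each \<open>\<epsilon> > 0\<close> a chain of one disc suffices: it sends 0 and
  \<open>tanh \<epsilon>\<close>, which have Poincare distance \<epsilon>, to the two
  points.\<close>

lemma kobayashi_dist_eq_0_on_line:
  fixes M :: "'n::finite cproj set" and \<Omega> :: "(complex ^ 'n) set"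
  assumes "quasiprojective M" "\<And>j. open (N j)" "incseq N" "M = (\<Union>j. N j)" "bounded \<Omega>"
    and "\<And>j. biholomorphic_to_proj \<Omega> (N j)"
    and "r > 0" "\<forall>x\<in>\<Omega>. \<exists>\<phi>\<in>Aut \<Omega>. ball (\<phi> x) r \<subseteq> \<Omega>"
    and "chart_inv i x \<in> M" "chart_inv i (x + b *s v) \<in> M"
  shows "kobayashi_dist M (chart_inv i x) (chart_inv i (x + b *s v)) \<le> 0"
proof (rule ereal_le_epsilon2)
  fix \<epsilon> :: real assume "\<epsilon> > 0"
    define p where "p = chart_inv i x"
    define q where "q = chart_inv i (x + b *s v)"
    define t where "t = tanh \<epsilon>"
    have t: "0 < t" "t < 1" using \<open>\<epsilon> > 0\<close> tanh_real_lt_1 by (simp_all add: t_def)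
    have "r * t / 2 > 0" using assms(7) t by simp
    then obtain j where j: "p \<in> N j" "q \<in> N j"
      and small: "\<And>g. holo_from_proj g (N j) \<Longrightarrow> g ` N j \<subseteq> \<Omega> \<Longrightarrow> norm (g q - g p) \<le> r * t / 2"
      unfolding p_def q_def using exhaustion_line_nearly_constant[OF assms(1-5,9,10)] by metis
    obtain G g where G: "holo_to_proj G \<Omega>" "G ` \<Omega> \<subseteq> N j" and g: "holo_from_proj g (N j)" "g ` N j \<subseteq> \<Omega>"
      and Gg: "\<And>q. q \<in> N j \<Longrightarrow> G (g q) = q" and ball: "ball (g p) r \<subseteq> \<Omega>"
      using normalized_coordinates[OF assms(6) j(1) assms(8)] by metis
    \<comment> \<open>Dividing by \<open>t\<close> makes the disc reach \<open>q\<close> at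
      parameter \<open>t\<close>. The bound \<open>r * t / 2\<close> on the displacement keeps
      \<open>norm u\<close> at most \<open>r / 2\<close>.\<close>
    define u where "u = complex_of_real (inverse t) *s (g q - g p)"
    define f where "f z = G (g p + z *s u)" for z
    have "norm u = norm (g q - g p) / t"
      using t unfolding u_def norm_vector_smult by (simp add: norm_inverse divide_inverse)
    also have "\<dots> \<le> r / 2" using small[OF g] t by (simp add: field_simps)
    finally have "norm u < r" using assms(7) by linarith
    then have "holo_disc M f"
      unfolding f_def using G(2) assms(4) by (intro holo_disc_affine[OF G(1) _ ball]) auto
    moreover have "f 0 = p" "f (of_real t) = q"
      using t j Gg by (simp_all add: f_def u_def vector_smult_assoc flip: of_real_mult)
    ultimately have chain: "[(f, 0, of_real t)] \<in> disc_chains M p q"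
      using t by (simp add: disc_chains_def)
    have "kobayashi_dist M p q \<le> ereal (poincare_dist 0 (of_real t))"
      using INF_lower[OF chain, of "\<lambda>cs. ereal (\<Sum>(f, a, b)\<leftarrow>cs. poincare_dist a b)"]
      by (simp add: kobayashi_dist_def)
    also have "poincare_dist 0 (of_real t) = \<epsilon>"
      using t by (simp add: poincare_dist_def t_def artanh_tanh_real)
    finally show "kobayashi_dist M (chart_inv i x) (chart_inv i (x + b *s v)) \<le> 0 + ereal \<epsilon>"
      by (simp add: p_def q_def)
qed

text \<open>Every \<open>\<alpha> > 0\<close> is realized by a disc, so the infimum is taken over
  all positive reals.\<close>

lemma kobayashi_metric_eq_0:
  fixes M :: "'n::finite cproj set" and \<Omega> :: "(complex ^ 'n) set"
  assumes "quasiprojective M" "\<And>j. open (N j)" "incseq N" "M = (\<Union>j. N j)" "bounded \<Omega>"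
    and "\<And>j. biholomorphic_to_proj \<Omega> (N j)"
    and "r > 0" "\<forall>x\<in>\<Omega>. \<exists>\<phi>\<in>Aut \<Omega>. ball (\<phi> x) r \<subseteq> \<Omega>"
    and "p \<in> M" "chart_dom i p"
  shows "kobayashi_metric M i p v = 0"
proof -
  have "\<exists>f. holo_disc M f \<and> f 0 = p \<and> (\<forall>k. complex_of_real \<alpha> * deriv (\<lambda>z. chart i (f z) $ k) 0 = v $ k)"
    if "\<alpha> > 0" for \<alpha>
  proof -
    define x where "x = chart i p"
    have x: "chart_inv i x = p" using assms(10) by (simp add: x_def chart_inv_chart)
    \<comment> \<open>Only the derivative estimate at 0 is wanted, so the second point on the line
      is taken equal to the first with \<open>b = 0\<close>.\<close>
    have "chart_inv i x \<in> M" and "chart_inv i (x + 0 *s v) \<in> M" and "r * \<alpha> / 2 > 0"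
      using assms(7,9) that by (simp_all add: x)
    note line = exhaustion_line_nearly_constant[OF assms(1-5) this]
    obtain j where j: "p \<in> N j"
      and small: "\<And>g. holo_from_proj g (N j) \<Longrightarrow> g ` N j \<subseteq> \<Omega> \<Longrightarrow>
        \<exists>w. ((\<lambda>t. g (chart_inv i (x + t *s v))) has_derivative (\<lambda>c. c *s w)) (at 0) \<and> norm w \<le> r * \<alpha> / 2"
    proof (rule line)
      fix j assume "chart_inv i x \<in> N j" and "\<And>g. holo_from_proj g (N j) \<Longrightarrow> g ` N j \<subseteq> \<Omega> \<Longrightarrow>
        norm (g (chart_inv i (x + 0 *s v)) - g (chart_inv i x)) \<le> r * \<alpha> / 2 \<and>
        (\<exists>w. ((\<lambda>t. g (chart_inv i (x + t *s v))) has_derivative (\<lambda>c. c *s w)) (at 0) \<and> norm w \<le> r * \<alpha> / 2)"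
      then show thesis by (intro that[of j]) (simp_all only: x)
    qed
    obtain G g where G: "holo_to_proj G \<Omega>" "G ` \<Omega> \<subseteq> N j" and g: "holo_from_proj g (N j)" "g ` N j \<subseteq> \<Omega>"
      and Gg: "\<And>q. q \<in> N j \<Longrightarrow> G (g q) = q" and ball: "ball (g p) r \<subseteq> \<Omega>"
      using normalized_coordinates[OF assms(6) j assms(8)] by metis
    define H where "H t = g (chart_inv i (x + t *s v))" for t
    obtain w where w: "(H has_derivative (\<lambda>c. c *s w)) (at 0)" "norm w \<le> r * \<alpha> / 2"
      using small[OF g] unfolding H_def by blast
    have H0: "H 0 = g p" by (simp add: H_def x)
    have "g p \<in> {x \<in> \<Omega>. chart_dom i (G x)}" using j g(2) Gg assms(10) by auto
    with G(1) obtain D where D: "((\<lambda>x. chart i (G x)) has_derivative D) (at (g p))"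
      and D_smult: "\<And>c v. D (c *s v) = c *s D v"
      unfolding holo_to_proj_def by (meson holo_onE)
    \<comment> \<open>Near 0 the map \<open>t \<mapsto> chart i (G (H t))\<close> is the line
      \<open>x + t *s v\<close> itself. Comparing its two derivatives gives
      \<open>D w = v\<close>.\<close>
    have "((\<lambda>t. chart i (G (H t))) has_derivative (\<lambda>c. c *s D w)) (at 0)"
      using has_derivative_compose[OF w(1), of "\<lambda>x. chart i (G x)" D] D by (simp add: H0 D_smult)
    then have "((\<lambda>t. x + t *s v) has_derivative (\<lambda>c. c *s D w)) (at 0)"
    proof (rule has_derivative_transform_within_open)
      show "open {t. chart_inv i (x + t *s v) \<in> N j}" using assms(2) by (rule open_line_preimage)
      show "0 \<in> {t. chart_inv i (x + t *s v) \<in> N j}" using j by (simp add: x)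
      show "chart i (G (H t)) = x + t *s v" if "t \<in> {t. chart_inv i (x + t *s v) \<in> N j}" for t
        using that Gg by (simp add: H_def chart_chart_inv)
    qed
    moreover have "((\<lambda>t. x + t *s v) has_derivative (\<lambda>c. c *s v)) (at 0)"
      by (auto intro!: derivative_eq_intros bounded_linear.has_derivative[OF bounded_linear_smult_left])
    ultimately have "(\<lambda>c. c *s D w) = (\<lambda>c. c *s v)" by (rule has_derivative_unique)
    then have "1 *s D w = 1 *s v" by metis
    then have Dw: "D w = v" by simp
    \<comment> \<open>The disc in direction \<open>w / \<alpha>\<close> has derivative
      \<open>v / \<alpha>\<close> in the chart, and the bound on \<open>w\<close> makes it fit in
      the ball.\<close>
    define u where "u = complex_of_real (inverse \<alpha>) *s w"
    define f where "f z = G (g p + z *s u)" for z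
    have "norm u = norm w / \<alpha>"
      using that unfolding u_def norm_vector_smult by (simp add: norm_inverse divide_inverse)
    also have "\<dots> \<le> r / 2" using w(2) that by (simp add: field_simps)
    finally have "norm u < r" using assms(7) by linarith
    then have "holo_disc M f"
      unfolding f_def using G(2) assms(4) by (intro holo_disc_affine[OF G(1) _ ball]) auto
    moreover have "f 0 = p" using j Gg by (simp add: f_def)
    moreover have "complex_of_real \<alpha> * deriv (\<lambda>z. chart i (f z) $ k) 0 = v $ k" for k
    proof -
      have "((\<lambda>x. chart i (G x)) has_derivative D) (at (g p + 0 *s u))" using D by simp
      from has_derivative_along_line[OF this D_smult]
      have "((\<lambda>z. chart i (f z) $ k) has_field_derivative D u $ k) (at 0)"
        unfolding f_def by (rule has_field_derivative_component)
      then have "deriv (\<lambda>z. chart i (f z) $ k) 0 = D u $ k" by (rule DERIV_imp_deriv)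
      also have "D u = complex_of_real (inverse \<alpha>) *s v" by (simp add: u_def D_smult Dw)
      finally show ?thesis using that by (simp flip: of_real_mult)
    qed
    ultimately show ?thesis by blast
  qed
  then have "{\<alpha>. 0 < \<alpha> \<and> (\<exists>f. holo_disc M f \<and> f 0 = p \<and>
      (\<forall>k. complex_of_real \<alpha> * deriv (\<lambda>z. chart i (f z) $ k) 0 = v $ k))} = {0<..}" by blast
  then show ?thesis unfolding kobayashi_metric_def by simp
qed

section \<open>Non-hyperbolicity and the corank\<close>

theorem theorem1p7:
  fixes M :: "'n::finite cproj set"
    and N :: "nat \<Rightarrow> 'n cproj set"
    and \<Omega> :: "(complex ^ 'n) set"
  assumes "quasiprojective M"
    and "\<And>j. open (N j)"
    and "incseq N"
    and "M = (\<Union>j. N j)"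
    and "complex_domain \<Omega>"
    and "\<And>j. biholomorphic_to_proj \<Omega> (N j)"
  shows "(bounded \<Omega> \<and> compact_space (Aut_quotient \<Omega>) \<longrightarrow> \<not> kobayashi_hyperbolic M) \<and>
    (CARD('n) \<ge> 2 \<and> (\<Omega> = ball 0 1 \<or> \<Omega> = unit_polydisc) \<longrightarrow>
       (\<exists>r\<ge>2. has_kobayashi_corank M r))"
proof (intro conjI impI)
  assume \<Omega>: "bounded \<Omega> \<and> compact_space (Aut_quotient \<Omega>)"
  have "open \<Omega>" using assms(5) by (simp add: complex_domain_def)
  from uniform_radius_of_compact_quotient[OF this conjunct2[OF \<Omega>]]
  obtain r where r: "r > 0" "\<forall>x\<in>\<Omega>. \<exists>\<phi>\<in>Aut \<Omega>. ball (\<phi> x) r \<subseteq> \<Omega>" by (elim exE conjE)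
  obtain y where "y \<in> \<Omega>" using assms(5) unfolding complex_domain_def by fast
  moreover obtain f where "bij_betw f \<Omega> (N 0)"
    using assms(6)[of 0] unfolding biholomorphic_to_proj_def by (elim exE conjE)
  ultimately have "f y \<in> N 0" by (rule bij_betwE[rule_format, rotated])
  then have "f y \<in> M" unfolding assms(4) by (rule UN_I[OF UNIV_I])
  then obtain p where p: "p \<in> M" ..
  obtain z where z: "z \<noteq> 0" "p = proj z" by (rule cproj_cases[of p])
  then obtain i where "z $ i \<noteq> 0" unfolding vec_eq_iff by auto
  with z have "chart_dom i p" by (simp add: chart_dom_proj)
  define x where "x = chart i p"
  have x: "chart_inv i x = p" using \<open>chart_dom i p\<close> by (simp add: x_def chart_inv_chart)
  \<comment> \<open>The vector with all entries 1 serves as a nonzero direction.\<close>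
  define v :: "complex ^ 'n" where "v = 1"
  have "open M" using assms(2,4) by auto
  then have "finite {t. chart_inv i (x + t *s v) \<notin> M}"
    using p x finite_line_complement[OF assms(1), of i x v] by simp
  \<comment> \<open>Avoiding 0 as well makes the second point on the line differ from
    \<open>p\<close>.\<close>
  then have "finite (insert 0 {t. chart_inv i (x + t *s v) \<notin> M})" by simp
  then obtain b where "b \<notin> insert 0 {t. chart_inv i (x + t *s v) \<notin> M}"
    using ex_new_if_finite[OF infinite_UNIV_char_0] by blast
  then have b: "b \<noteq> 0" "chart_inv i (x + b *s v) \<in> M" by simp_all
  have "x \<noteq> x + b *s v" using b(1) by (simp add: v_def vec_eq_iff)
  then have "chart_inv i x \<noteq> chart_inv i (x + b *s v)"
    using chart_chart_inv(2) by metis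
  moreover have xM: "chart_inv i x \<in> M" using p by (simp only: x)
  moreover have "kobayashi_dist M (chart_inv i x) (chart_inv i (x + b *s v)) \<le> 0"
    by (rule kobayashi_dist_eq_0_on_line[OF assms(1-4) conjunct1[OF \<Omega>] assms(6) r xM b(2)])
  ultimately show "\<not> kobayashi_hyperbolic M"
    using b(2) by (auto simp: kobayashi_hyperbolic_def not_less)
next
  assume n: "CARD('n) \<ge> 2 \<and> (\<Omega> = ball 0 1 \<or> \<Omega> = unit_polydisc)"
  have poly_sub: "ball 0 1 \<subseteq> (unit_polydisc :: (complex ^ 'n) set)"
    using order.strict_trans1[OF Finite_Cartesian_Product.norm_nth_le] by (auto simp: unit_polydisc_def)
  have sub: "ball 0 1 \<subseteq> \<Omega>" using n poly_sub by auto
  \<comment> \<open>Every point can be moved to the origin, around which both model domains contain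
    the unit ball, so the uniform radius is 1.\<close>
  have hom: "\<forall>x\<in>\<Omega>. \<exists>\<phi>\<in>Aut \<Omega>. ball (\<phi> x) 1 \<subseteq> \<Omega>"
  proof
    fix x assume "x \<in> \<Omega>"
    then obtain \<phi> where "\<phi> \<in> Aut \<Omega>" "\<phi> x = 0"
      using n ball_homogeneous[of x] polydisc_homogeneous[of x] by auto
    then show "\<exists>\<phi>\<in>Aut \<Omega>. ball (\<phi> x) 1 \<subseteq> \<Omega>" using sub by (intro bexI[of _ \<phi>]) simp_all
  qed
  have "bounded (unit_polydisc :: (complex ^ 'n) set)"
    unfolding bounded_iff
  proof (intro exI ballI)
    fix z :: "complex ^ 'n" assume "z \<in> unit_polydisc"
    then have "(\<Sum>k\<in>UNIV. cmod (z $ k)) \<le> (\<Sum>k\<in>(UNIV :: 'n set). 1)"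
      by (intro sum_mono) (auto simp: unit_polydisc_def less_imp_le)
    with norm_le_sum_components show "norm z \<le> (\<Sum>k\<in>(UNIV :: 'n set). 1)" by (rule order_trans)
  qed
  then have "bounded \<Omega>" using n by auto
  \<comment> \<open>The null space is the whole tangent space, so the corank is
    \<open>CARD('n)\<close>, which is at least 2 by assumption.\<close>
  have "{v. kobayashi_metric M i p v = 0} = UNIV" if "p \<in> M" "chart_dom i p" for p i
    using kobayashi_metric_eq_0[OF assms(1-4) \<open>bounded \<Omega>\<close> assms(6) zero_less_one hom that] by simp
  then have "has_kobayashi_corank M (CARD('n))"
    by (simp add: has_kobayashi_corank_def card_cart_basis vec.subspace_UNIV)
  then show "\<exists>r\<ge>2. has_kobayashi_corank M r" using n by blast
qed

end
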